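(* Let $F:\mathcal{E}\to\mathcal{B}$ be a Kumjian-Pask fibration. For all $\mu,\nu\in\mathcal{E}$ with $s(\mu)=s(\nu)$, the maps $r|_{Z(\mu,\nu)}:Z(\mu,\nu)\to Z(\mu)$ and $s|_{Z(\mu,\nu)}:Z(\mu,\nu)\to Z(\nu)$ are homeomorphisms, and $G_F$ is étale.
   Context: All categories are small and identified with their sets of morphisms. Composition is written anti-diagrammatically: for $\beta:C\to B$ and $\alpha:B\to A$ the composite is $\alpha\beta$; $r(\alpha)$ is the codomain and $s(\alpha)$ the domain of $\alpha$. For an object $X$ of $\mathcal{C}$, $X\mathcal{C}$ is the set of morphisms with codomain $X$. A functor $F:\mathcal{E}\to\mathcal{B}$ is a discrete Conduché fibration if for every morphism $\phi$ of $\mathcal{E}$ and every factorization $F(\phi)=\rho\lambda$ in $\mathcal{B}$ there is a unique factorization $\phi=\tilde\rho\tilde\lambda$ in $\mathcal{E}$ with $F(\tilde\rho)=\rho$, $F(\tilde\lambda)=\lambda$. A category is right Ore if for every cospan $m,n$ (morphisms with common codomain) there are $p,q$ with $mp=nq$. It is strongly right Ore if it is right Ore and, for every cospan $m,n$ and all $p_1,p_2,q_1,q_2$ with $mp_i=nq_i$ ($i=1,2$), there exist $a,b$ with $p_1a=p_2b$ and $q_1a=q_2b$. The slice category $\mathcal{C}/X$ has as objects the elements of $X\mathcal{C}$ and as morphisms the pairs $(\alpha,\gamma)$ with $\alpha\in X\mathcal{C}$, $r(\gamma)=s(\alpha)$; $(\alpha,\gamma)$ has range $\alpha$ and source $\alpha\gamma$,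 and $(\alpha,\gamma)(\alpha\gamma,\delta)=(\alpha,\gamma\delta)$. A functor $F:\mathcal{E}\to\mathcal{B}$ induces functors $F:\mathcal{E}/X\to\mathcal{B}/F(X)$. $F$ is locally split if for every object $X$ of $\mathcal{E}$ there is a functor $x:\mathcal{B}/F(X)\to\mathcal{E}/X$ with $F\circ x=\mathrm{Id}$. A Kumjian-Pask fibration is a locally split discrete Conduché fibration $F:\mathcal{E}\to\mathcal{B}$ with $\mathcal{B}$ strongly right Ore. An infinite path to an object $X$ of $\mathcal{E}$ is a functor $x:\mathcal{B}/F(X)\to\mathcal{E}/X$ with $F\circ x=\mathrm{Id}_{\mathcal{B}/F(X)}$; $Z(X)$ is the set of these (a path remembers its object $X=:r(x)$, so the $Z(X)$ are pairwise disjoint), and $F^\infty=\bigcup_X Z(X)$. For $a\in F(X)\mathcal{B}$, $x(a)\in X\mathcal{E}$ is the image of the object $a$; for a morphism $(a,b)$ of $\mathcal{B}/F(X)$ write $x(a,b)=(x_1(a,b),x_2(a,b))$, so $x_1(a,b)=x(a)$, $F(x_2(a,b))=b$ and $x(a)x_2(a,b)=x(ab)$. For a morphism $\mu$ of $\mathcal{E}$, $Z(\mu)=\{x\in Z(r(\mu)):x(F(\mu))=\mu\}$. $F^\infty$ carries the topology with basis $\{Z(\alpha):\alpha\in\mathcal{E}\}$, subsets the subspace topology. For $\mu\in\mathcal{E}$, $\mathrm{res}_\mu:Z(\mu)\to Z(s(\mu))$ is defined by $\mathrm{res}_\mu(x)(a,b)=(x_2(F(\mu),a),x_2(F(\mu)a,b))$.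 It is a bijection, with inverse $\mathrm{ind}_\mu:Z(s(\mu))\to Z(\mu)$; $\mathrm{ind}_\mu(x)$ is the unique $y\in Z(\mu)$ with $y(F(\mu)a)=\mu\,x(a)$ for all $a\in F(s(\mu))\mathcal{B}$. Let $\mathcal{G}_F=\{(\mu,\nu,x)\in\mathcal{E}\times\mathcal{E}\times F^\infty: x\in Z(\nu),\ s(\mu)=s(\nu)\}$. Define $(\mu,\nu,x)\sim(\mu',\nu',x')$ iff (1) $x=x'$; (2) there is $\lambda\in\mathcal{E}$ with $x\in Z(\lambda)\subset Z(\nu)\cap Z(\nu')$ and $\mathrm{ind}_\mu\circ\mathrm{res}_\nu|_{Z(\lambda)}=\mathrm{ind}_{\mu'}\circ\mathrm{res}_{\nu'}|_{Z(\lambda)}$; (3) there are $a,b\in\mathcal{B}$ with $F(\mu)a=F(\mu')b$ and $F(\nu)a=F(\nu')b$. $G_F=\mathcal{G}_F/\sim$, with classes $[\mu,\nu,x]$. $G_F$ is a groupoid with unit space identified with $F^\infty$ via $x\mapsto[r(x),r(x),x]$ (objects identified with identity morphisms); $[\mu,\nu,x]$ has source $s([\mu,\nu,x])=x$ and range $r([\mu,\nu,x])=\mathrm{ind}_\mu(\mathrm{res}_\nu(x))$; if $x=\mathrm{ind}_\sigma(\mathrm{res}_\tau(y))$ then $[\mu,\nu,x][\sigma,\tau,y]=[\mu\gamma,\tau\eta,y]$, where $a,b\in\mathcal{B}$ are any morphisms with $F(\nu)a=F(\sigma)b$ and $\gamma=x_2(F(\nu),a)$, $\eta=x_2(F(\sigma),b)$;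 the inverse of $[\mu,\nu,x]$ is $[\nu,\mu,\mathrm{ind}_\mu(\mathrm{res}_\nu(x))]$. For $\mu,\nu\in\mathcal{E}$ with $s(\mu)=s(\nu)$, $Z(\mu,\nu)=\{[\mu,\nu,x]:x\in Z(\nu)\}\subset G_F$; these sets form a basis for the topology of $G_F$, making it a topological groupoid. An open subset $B$ of a topological groupoid is a bisection if $r|_B$ and $s|_B$ are injective and open; a topological groupoid is étale if it has a basis of bisections. *)

theory Defs
  imports "HOL-Analysis.Analysis"
begin

section \<open>Small categories, given by their morphisms\<close>

text \<open>Objects are identified with their identity morphisms; \<open>src\<close> and \<open>rng\<close> are the domain and
  the codomain of a morphism. Composition is anti-diagrammatic: \<open>\<alpha> \<odot> \<beta>\<close> is meaningful
  for \<open>src \<alpha> = rng \<beta>\<close>.\<close>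

record 'a cat =
  mor :: "'a set"
  src :: "'a \<Rightarrow> 'a"
  rng :: "'a \<Rightarrow> 'a"
  cmp :: "'a \<Rightarrow> 'a \<Rightarrow> 'a" (infixl "\<odot>\<index>" 70)

definition composable :: "'a cat \<Rightarrow> 'a \<Rightarrow> 'a \<Rightarrow> bool" where
  "composable C \<alpha> \<beta> \<longleftrightarrow> \<alpha> \<in> mor C \<and> \<beta> \<in> mor C \<and> src C \<alpha> = rng C \<beta>"

definition category :: "'a cat \<Rightarrow> bool" where
  "category C \<longleftrightarrow>
     (\<forall>\<alpha>\<in>mor C. src C \<alpha> \<in> mor C \<and> rng C \<alpha> \<in> mor C \<and>
        src C (src C \<alpha>) = src C \<alpha> \<and> rng C (src C \<alpha>) = src C \<alpha> \<and>
        src C (rng C \<alpha>) = rng C \<alpha> \<and> rng C (rng C \<alpha>) = rng C \<alpha> \<and>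
        rng C \<alpha> \<odot>\<^bsub>C\<^esub> \<alpha> = \<alpha> \<and> \<alpha> \<odot>\<^bsub>C\<^esub> src C \<alpha> = \<alpha>) \<and>
     (\<forall>\<alpha> \<beta>. composable C \<alpha> \<beta> \<longrightarrow>
        \<alpha> \<odot>\<^bsub>C\<^esub> \<beta> \<in> mor C \<and> rng C (\<alpha> \<odot>\<^bsub>C\<^esub> \<beta>) = rng C \<alpha> \<and> src C (\<alpha> \<odot>\<^bsub>C\<^esub> \<beta>) = src C \<beta>) \<and>
     (\<forall>\<alpha> \<beta> \<gamma>. composable C \<alpha> \<beta> \<and> composable C \<beta> \<gamma> \<longrightarrow>
        (\<alpha> \<odot>\<^bsub>C\<^esub> \<beta>) \<odot>\<^bsub>C\<^esub> \<gamma> = \<alpha> \<odot>\<^bsub>C\<^esub> (\<beta> \<odot>\<^bsub>C\<^esub> \<gamma>))"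

definition obj :: "'a cat \<Rightarrow> 'a set" where
  "obj C = {X \<in> mor C. src C X = X}"

definition into :: "'a cat \<Rightarrow> 'a \<Rightarrow> 'a set" where
  "into C X = {\<alpha> \<in> mor C. rng C \<alpha> = X}"

text \<open>Preservation of identities is contained in preservation of \<open>src\<close> and \<open>rng\<close>.\<close>

definition is_functor :: "'e cat \<Rightarrow> 'b cat \<Rightarrow> ('e \<Rightarrow> 'b) \<Rightarrow> bool" where
  "is_functor E B F \<longleftrightarrow> category E \<and> category B \<and>
     (\<forall>\<alpha>\<in>mor E. F \<alpha> \<in> mor B \<and> F (src E \<alpha>) = src B (F \<alpha>) \<and> F (rng E \<alpha>) = rng B (F \<alpha>)) \<and>
     (\<forall>\<alpha> \<beta>. composable E \<alpha> \<beta> \<longrightarrow> F (\<alpha> \<odot>\<^bsub>E\<^esub> \<beta>) = F \<alpha> \<odot>\<^bsub>B\<^esub> F \<beta>)"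

definition discrete_Conduche_fibration :: "'e cat \<Rightarrow> 'b cat \<Rightarrow> ('e \<Rightarrow> 'b) \<Rightarrow> bool" where
  "discrete_Conduche_fibration E B F \<longleftrightarrow> is_functor E B F \<and>
     (\<forall>\<phi>\<in>mor E. \<forall>\<rho> \<kappa>. composable B \<rho> \<kappa> \<and> F \<phi> = \<rho> \<odot>\<^bsub>B\<^esub> \<kappa> \<longrightarrow>
        (\<exists>!p. case p of (\<rho>', \<kappa>') \<Rightarrow>
           composable E \<rho>' \<kappa>' \<and> \<phi> = \<rho>' \<odot>\<^bsub>E\<^esub> \<kappa>' \<and> F \<rho>' = \<rho> \<and> F \<kappa>' = \<kappa>))"

definition completes_cospan :: "'a cat \<Rightarrow> 'a \<Rightarrow> 'a \<Rightarrow> 'a \<Rightarrow> 'a \<Rightarrow> bool" where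
  "completes_cospan C m n p q \<longleftrightarrow>
     composable C m p \<and> composable C n q \<and> m \<odot>\<^bsub>C\<^esub> p = n \<odot>\<^bsub>C\<^esub> q"

definition right_Ore :: "'a cat \<Rightarrow> bool" where
  "right_Ore C \<longleftrightarrow>
     (\<forall>m\<in>mor C. \<forall>n\<in>mor C. rng C m = rng C n \<longrightarrow> (\<exists>p q. completes_cospan C m n p q))"

definition strongly_right_Ore :: "'a cat \<Rightarrow> bool" where
  "strongly_right_Ore C \<longleftrightarrow> right_Ore C \<and>
     (\<forall>m\<in>mor C. \<forall>n\<in>mor C. rng C m = rng C n \<longrightarrow>
        (\<forall>p\<^sub>1 p\<^sub>2 q\<^sub>1 q\<^sub>2. completes_cospan C m n p\<^sub>1 q\<^sub>1 \<and> completes_cospan C m n p\<^sub>2 q\<^sub>2 \<longrightarrow>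
           (\<exists>a b. completes_cospan C p\<^sub>1 p\<^sub>2 a b \<and> completes_cospan C q\<^sub>1 q\<^sub>2 a b)))"

text \<open>The object \<open>\<alpha>\<close> of the slice is, as an identity morphism, the pair \<open>(\<alpha>, s(\<alpha>))\<close>.\<close>

definition slice :: "'a cat \<Rightarrow> 'a \<Rightarrow> ('a \<times> 'a) cat" where
  "slice C X = \<lparr>
     mor = {(\<alpha>, \<gamma>). \<alpha> \<in> into C X \<and> composable C \<alpha> \<gamma>},
     src = (\<lambda>(\<alpha>, \<gamma>). (\<alpha> \<odot>\<^bsub>C\<^esub> \<gamma>, src C \<gamma>)),
     rng = (\<lambda>(\<alpha>, \<gamma>). (\<alpha>, src C \<alpha>)),
     cmp = (\<lambda>(\<alpha>, \<gamma>) (\<beta>, \<delta>). (\<alpha>, \<gamma> \<odot>\<^bsub>C\<^esub> \<delta>)) \<rparr>"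

text \<open>The functor induced by \<open>F\<close> on slices is \<open>map_prod F F\<close>.\<close>

definition slice_section ::
    "'e cat \<Rightarrow> 'b cat \<Rightarrow> ('e \<Rightarrow> 'b) \<Rightarrow> 'e \<Rightarrow> ('b \<times> 'b \<Rightarrow> 'e \<times> 'e) \<Rightarrow> bool" where
  "slice_section E B F X x \<longleftrightarrow> is_functor (slice B (F X)) (slice E X) x \<and>
     (\<forall>m\<in>mor (slice B (F X)). map_prod F F (x m) = m)"

definition locally_split :: "'e cat \<Rightarrow> 'b cat \<Rightarrow> ('e \<Rightarrow> 'b) \<Rightarrow> bool" where
  "locally_split E B F \<longleftrightarrow> (\<forall>X\<in>obj E. \<exists>x. slice_section E B F X x)"

definition Kumjian_Pask_fibration :: "'e cat \<Rightarrow> 'b cat \<Rightarrow> ('e \<Rightarrow> 'b) \<Rightarrow> bool" where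
  "Kumjian_Pask_fibration E B F \<longleftrightarrow>
     discrete_Conduche_fibration E B F \<and> locally_split E B F \<and> strongly_right_Ore B"


section \<open>Infinite paths\<close>

text \<open>A path is stored together with its object. The function part is required to be
  \<open>undefined\<close> off the slice category, so that equality of paths is equality of functors.\<close>

type_synonym ('e, 'b) path = "'e \<times> ('b \<times> 'b \<Rightarrow> 'e \<times> 'e)"

definition paths_to :: "'e cat \<Rightarrow> 'b cat \<Rightarrow> ('e \<Rightarrow> 'b) \<Rightarrow> 'e \<Rightarrow> ('e, 'b) path set" where
  "paths_to E B F X =
     {(X, x) |x. slice_section E B F X x \<and> x \<in> extensional (mor (slice B (F X)))}"

definition inf_paths :: "'e cat \<Rightarrow> 'b cat \<Rightarrow> ('e \<Rightarrow> 'b) \<Rightarrow> ('e, 'b) path set" where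
  "inf_paths E B F = (\<Union>X\<in>obj E. paths_to E B F X)"

text \<open>\<open>path_at B x a\<close> is \<open>x(a)\<close>, and \<open>path_step x a b\<close> is \<open>x\<^sub>2(a, b)\<close>.\<close>

definition path_at :: "'b cat \<Rightarrow> ('e, 'b) path \<Rightarrow> 'b \<Rightarrow> 'e" where
  "path_at B x a = fst (snd x (a, src B a))"

definition path_step :: "('e, 'b) path \<Rightarrow> 'b \<Rightarrow> 'b \<Rightarrow> 'e" where
  "path_step x a b = snd (snd x (a, b))"

definition cyl :: "'e cat \<Rightarrow> 'b cat \<Rightarrow> ('e \<Rightarrow> 'b) \<Rightarrow> 'e \<Rightarrow> ('e, 'b) path set" where
  "cyl E B F \<mu> = {x \<in> paths_to E B F (rng E \<mu>). path_at B x (F \<mu>) = \<mu>}"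

text \<open>For a Kumjian--Pask fibration the sets below form a basis, so the topology they generate is
  the one having them as a basis. The same remark applies to the topology of the groupoid.\<close>

definition path_topology :: "'e cat \<Rightarrow> 'b cat \<Rightarrow> ('e \<Rightarrow> 'b) \<Rightarrow> ('e, 'b) path topology" where
  "path_topology E B F = topology_generated_by {cyl E B F \<alpha> |\<alpha>. \<alpha> \<in> mor E}"

definition res ::
    "'e cat \<Rightarrow> 'b cat \<Rightarrow> ('e \<Rightarrow> 'b) \<Rightarrow> 'e \<Rightarrow> ('e, 'b) path \<Rightarrow> ('e, 'b) path" where
  "res E B F \<mu> x =
     (src E \<mu>,
      restrict (\<lambda>(a, b). (path_step x (F \<mu>) a, path_step x (F \<mu> \<odot>\<^bsub>B\<^esub> a) b))
        (mor (slice B (F (src E \<mu>)))))"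

definition ind ::
    "'e cat \<Rightarrow> 'b cat \<Rightarrow> ('e \<Rightarrow> 'b) \<Rightarrow> 'e \<Rightarrow> ('e, 'b) path \<Rightarrow> ('e, 'b) path" where
  "ind E B F \<mu> = inv_into (cyl E B F \<mu>) (res E B F \<mu>)"


section \<open>Topological groupoids\<close>

text \<open>The unit space is a space of its own, embedded into the arrows by \<open>gunit\<close>; continuity of
  \<open>gunit\<close> and \<open>grng\<close> makes this embedding a homeomorphism onto its image. The arrows and the units
  are the points of the two topologies. The product \<open>gmult G g h\<close> is meaningful for
  \<open>gsrc G g = grng G h\<close>.\<close>

record ('g, 'u) top_groupoid =
  arrows :: "'g topology"
  units :: "'u topology"
  grng :: "'g \<Rightarrow> 'u"
  gsrc :: "'g \<Rightarrow> 'u"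
  gunit :: "'u \<Rightarrow> 'g"
  gmult :: "'g \<Rightarrow> 'g \<Rightarrow> 'g"
  ginv :: "'g \<Rightarrow> 'g"

definition gcomposable :: "('g, 'u) top_groupoid \<Rightarrow> ('g \<times> 'g) set" where
  "gcomposable G =
     {(g, h). g \<in> topspace (arrows G) \<and> h \<in> topspace (arrows G) \<and> gsrc G g = grng G h}"

definition is_groupoid :: "('g, 'u) top_groupoid \<Rightarrow> bool" where
  "is_groupoid G \<longleftrightarrow>
     (\<forall>g\<in>topspace (arrows G). grng G g \<in> topspace (units G) \<and> gsrc G g \<in> topspace (units G)) \<and>
     (\<forall>u\<in>topspace (units G). gunit G u \<in> topspace (arrows G) \<and>
        grng G (gunit G u) = u \<and> gsrc G (gunit G u) = u) \<and>
     (\<forall>(g, h)\<in>gcomposable G. gmult G g h \<in> topspace (arrows G) \<and>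
        grng G (gmult G g h) = grng G g \<and> gsrc G (gmult G g h) = gsrc G h) \<and>
     (\<forall>g h k. (g, h) \<in> gcomposable G \<and> (h, k) \<in> gcomposable G \<longrightarrow>
        gmult G (gmult G g h) k = gmult G g (gmult G h k)) \<and>
     (\<forall>g\<in>topspace (arrows G).
        gmult G (gunit G (grng G g)) g = g \<and> gmult G g (gunit G (gsrc G g)) = g) \<and>
     (\<forall>g\<in>topspace (arrows G). ginv G g \<in> topspace (arrows G) \<and>
        grng G (ginv G g) = gsrc G g \<and> gsrc G (ginv G g) = grng G g \<and>
        gmult G g (ginv G g) = gunit G (grng G g) \<and> gmult G (ginv G g) g = gunit G (gsrc G g))"

definition topological_groupoid :: "('g, 'u) top_groupoid \<Rightarrow> bool" where
  "topological_groupoid G \<longleftrightarrow> is_groupoid G \<and>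
     continuous_map (arrows G) (units G) (grng G) \<and>
     continuous_map (arrows G) (units G) (gsrc G) \<and>
     continuous_map (units G) (arrows G) (gunit G) \<and>
     continuous_map (subtopology (prod_topology (arrows G) (arrows G)) (gcomposable G))
       (arrows G) (\<lambda>(g, h). gmult G g h) \<and>
     continuous_map (arrows G) (arrows G) (ginv G)"

definition bisection :: "('g, 'u) top_groupoid \<Rightarrow> 'g set \<Rightarrow> bool" where
  "bisection G S \<longleftrightarrow> openin (arrows G) S \<and>
     inj_on (grng G) S \<and> open_map (subtopology (arrows G) S) (units G) (grng G) \<and>
     inj_on (gsrc G) S \<and> open_map (subtopology (arrows G) S) (units G) (gsrc G)"

definition etale :: "('g, 'u) top_groupoid \<Rightarrow> bool" where
  "etale G \<longleftrightarrow> topological_groupoid G \<and>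
     (\<exists>\<B>. (\<forall>S\<in>\<B>. bisection G S) \<and> openin (arrows G) = arbitrary union_of (\<lambda>S. S \<in> \<B>))"


section \<open>The groupoid of a Kumjian--Pask fibration\<close>

type_synonym ('e, 'b) triple = "'e \<times> 'e \<times> ('e, 'b) path"

definition triples :: "'e cat \<Rightarrow> 'b cat \<Rightarrow> ('e \<Rightarrow> 'b) \<Rightarrow> ('e, 'b) triple set" where
  "triples E B F =
     {(\<mu>, \<nu>, x). \<mu> \<in> mor E \<and> \<nu> \<in> mor E \<and> x \<in> cyl E B F \<nu> \<and> src E \<mu> = src E \<nu>}"

definition triple_rel ::
    "'e cat \<Rightarrow> 'b cat \<Rightarrow> ('e \<Rightarrow> 'b) \<Rightarrow> (('e, 'b) triple \<times> ('e, 'b) triple) set" where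
  "triple_rel E B F =
     {((\<mu>, \<nu>, x), (\<mu>', \<nu>', x')).
        (\<mu>, \<nu>, x) \<in> triples E B F \<and> (\<mu>', \<nu>', x') \<in> triples E B F \<and>
        x = x' \<and>
        (\<exists>\<kappa>\<in>mor E. x \<in> cyl E B F \<kappa> \<and> cyl E B F \<kappa> \<subseteq> cyl E B F \<nu> \<inter> cyl E B F \<nu>' \<and>
           (\<forall>y\<in>cyl E B F \<kappa>.
              ind E B F \<mu> (res E B F \<nu> y) = ind E B F \<mu>' (res E B F \<nu>' y))) \<and>
        (\<exists>a b. completes_cospan B (F \<mu>) (F \<mu>') a b \<and> completes_cospan B (F \<nu>) (F \<nu>') a b)}"

definition tclass ::
    "'e cat \<Rightarrow> 'b cat \<Rightarrow> ('e \<Rightarrow> 'b) \<Rightarrow> 'e \<Rightarrow> 'e \<Rightarrow> ('e, 'b) path \<Rightarrow> ('e, 'b) triple set" where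
  "tclass E B F \<mu> \<nu> x = triple_rel E B F `` {(\<mu>, \<nu>, x)}"

definition cyl2 ::
    "'e cat \<Rightarrow> 'b cat \<Rightarrow> ('e \<Rightarrow> 'b) \<Rightarrow> 'e \<Rightarrow> 'e \<Rightarrow> ('e, 'b) triple set set" where
  "cyl2 E B F \<mu> \<nu> = {tclass E B F \<mu> \<nu> x |x. x \<in> cyl E B F \<nu>}"

text \<open>The set of arrows is \<open>triples E B F // triple_rel E B F\<close>, the union of the sets
  \<open>cyl2 E B F \<mu> \<nu>\<close>. Range, source, product and inverse are determined by representatives. In the
  product, \<open>a\<close> and \<open>b\<close> range over all completions of the cospan \<open>F \<nu>\<close>, \<open>F \<sigma>\<close>, and
  \<open>\<gamma> = x\<^sub>2(F(\<nu>), a)\<close>, \<open>\<eta> = x\<^sub>2(F(\<sigma>), b)\<close>.\<close>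

definition KP_groupoid ::
    "'e cat \<Rightarrow> 'b cat \<Rightarrow> ('e \<Rightarrow> 'b) \<Rightarrow> (('e, 'b) triple set, ('e, 'b) path) top_groupoid" where
  "KP_groupoid E B F = \<lparr>
     arrows = topology_generated_by
       {cyl2 E B F \<mu> \<nu> |\<mu> \<nu>. \<mu> \<in> mor E \<and> \<nu> \<in> mor E \<and> src E \<mu> = src E \<nu>},
     units = path_topology E B F,
     grng = (\<lambda>g. THE z. \<exists>\<mu> \<nu> x. (\<mu>, \<nu>, x) \<in> g \<and> z = ind E B F \<mu> (res E B F \<nu> x)),
     gsrc = (\<lambda>g. THE x. \<exists>\<mu> \<nu>. (\<mu>, \<nu>, x) \<in> g),
     gunit = (\<lambda>x. tclass E B F (fst x) (fst x) x),
     gmult = (\<lambda>g h. THE k. \<exists>\<mu> \<nu> x \<sigma> \<tau> y a b.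
        (\<mu>, \<nu>, x) \<in> g \<and> (\<sigma>, \<tau>, y) \<in> h \<and> x = ind E B F \<sigma> (res E B F \<tau> y) \<and>
        completes_cospan B (F \<nu>) (F \<sigma>) a b \<and>
        k = tclass E B F (\<mu> \<odot>\<^bsub>E\<^esub> path_step x (F \<nu>) a) (\<tau> \<odot>\<^bsub>E\<^esub> path_step x (F \<sigma>) b) y),
     ginv = (\<lambda>g. THE k. \<exists>\<mu> \<nu> x. (\<mu>, \<nu>, x) \<in> g \<and>
        k = tclass E B F \<nu> \<mu> (ind E B F \<mu> (res E B F \<nu> x))) \<rparr>"

end

theory Submission
  imports Defs
begin

text \<open>
  \<^bold>\<open>Paths.\<close> By unique factorisation an infinite path is determined by its values on objects, and a
  family of lifts \<open>a \<mapsto> f(a)\<close> arises from a path as soon as each \<open>f(ab)\<close> extends \<open>f(a)\<close> by a lift of \<open>b\<close>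
  (\<open>coherent_path\<close>). The shift \<open>res\<close> is injective on \<open>Z(\<mu>)\<close> because, by the Ore condition, the
  multiples of \<open>F(\<mu>)\<close> are cofinal; it is onto because the strong Ore condition makes the values
  prescribed through different multiples agree (\<open>res_surj\<close>).

  \<^bold>\<open>Arrows.\<close> An arrow \<open>[\<mu>, \<nu>, x]\<close> replaces the initial segment \<open>\<nu>\<close> of \<open>x\<close> by \<open>\<mu>\<close>. It is determined by its
  range, its source \<open>x\<close> and the fraction \<open>F(\<mu>)F(\<nu>)\<^sup>-\<^sup>1\<close>: the local condition in the definition of the
  relation may be replaced by equality of the ranges (\<open>rel_iff\<close>). Moreover \<open>[\<mu>, \<nu>, x] = [\<mu>\<gamma>, \<nu>\<gamma>, x]\<close>
  whenever \<open>x \<in> Z(\<nu>\<gamma>)\<close>, and equal arrows have a common extension of this kind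
  (\<open>common_extension_of_arrow\<close>). Hence any two composable arrows can be written \<open>[\<mu>, \<nu>, x]\<close> and
  \<open>[\<nu>, \<tau>, y]\<close> with the same middle leg, and their product is then \<open>[\<mu>, \<tau>, y]\<close>. In this form the groupoid
  laws are immediate; that the product does not depend on the choices is the multiplication of
  fractions, and this is the second place where the strong Ore condition enters.

  \<^bold>\<open>Topology.\<close> If \<open>[\<mu>, \<nu>, x]\<close> lies in \<open>Z(\<alpha>, \<beta>)\<close>, a common extension gives
  \<open>[\<mu>, \<nu>, x] \<in> Z(\<mu>\<gamma>, \<nu>\<gamma>) \<subseteq> Z(\<alpha>, \<beta>)\<close> (\<open>cyl2_neighbourhood\<close>). So these sets form a base, and the unit map
  and the product are continuous. The source map sends \<open>Z(\<mu>, \<nu>)\<close> bijectively onto \<open>Z(\<nu>)\<close>, so it is open,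
  and its continuity follows from a common refinement of cylinders. Inversion exchanges \<open>Z(\<mu>, \<nu>)\<close> and
  \<open>Z(\<nu>, \<mu>)\<close>, which transfers all this to the range map. An injective, continuous, open map is a
  homeomorphism onto its image, and the basic sets are bisections.
\<close>

section \<open>Bases and open maps\<close>

text \<open>Sets that are neighbourhoods, in terms of the base, of each of their points are closed under unions
  and, by the base property, under binary intersections; so generating adds nothing else.\<close>

lemma openin_generated_by_base_iff:
  assumes "\<And>U V x. U \<in> S \<Longrightarrow> V \<in> S \<Longrightarrow> x \<in> U \<Longrightarrow> x \<in> V \<Longrightarrow> \<exists>W\<in>S. x \<in> W \<and> W \<subseteq> U \<inter> V"
  shows "openin (topology_generated_by S) U \<longleftrightarrow> (\<forall>x\<in>U. \<exists>V\<in>S. x \<in> V \<and> V \<subseteq> U)"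
proof
  assume "openin (topology_generated_by S) U"
  then have "generate_topology_on S U" by (simp add: openin_topology_generated_by_iff)
  then show "\<forall>x\<in>U. \<exists>V\<in>S. x \<in> V \<and> V \<subseteq> U"
  proof induction
    case (Int U V)
    show ?case
    proof
      fix x assume "x \<in> U \<inter> V"
      then obtain U' V' where "U' \<in> S" "x \<in> U'" "U' \<subseteq> U" "V' \<in> S" "x \<in> V'" "V' \<subseteq> V"
        using Int.IH by blast
      then show "\<exists>W\<in>S. x \<in> W \<and> W \<subseteq> U \<inter> V" using assms[of U' V' x] by blast
    qed
  next
    case (UN K)
    show ?case
    proof
      fix x assume "x \<in> \<Union>K"
      then obtain k where k: "k \<in> K" "x \<in> k" by blast
      then obtain V where "V \<in> S" "x \<in> V" "V \<subseteq> k" using UN.IH by blast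
      then show "\<exists>V\<in>S. x \<in> V \<and> V \<subseteq> \<Union>K" using k(1) by blast
    qed
  next
    case (Basis s)
    then show ?case by blast
  qed simp
next
  assume "\<forall>x\<in>U. \<exists>V\<in>S. x \<in> V \<and> V \<subseteq> U"
  then have "U = \<Union>{V \<in> S. V \<subseteq> U}" by blast
  moreover have "openin (topology_generated_by S) (\<Union>{V \<in> S. V \<subseteq> U})"
    by (rule openin_Union) (simp add: topology_generated_by_Basis)
  ultimately show "openin (topology_generated_by S) U" by simp
qed

lemma homeomorphic_map_on_open:
  assumes f: "continuous_map X Y f" and op: "\<And>U. openin X U \<Longrightarrow> openin Y (f ` U)"
    and S: "openin X S" and inj: "inj_on f S"
  shows "homeomorphic_map (subtopology X S) (subtopology Y (f ` S)) f"
proof (rule bijective_open_imp_homeomorphic_map)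
  have T: "topspace (subtopology X S) = S" "topspace (subtopology Y (f ` S)) = f ` S"
    using openin_subset[OF S] openin_subset[OF op[OF S]] by auto
  show "continuous_map (subtopology X S) (subtopology Y (f ` S)) f"
    using f T by (simp add: continuous_map_in_subtopology continuous_map_from_subtopology)
  show "open_map (subtopology X S) (subtopology Y (f ` S)) f"
    using op S by (auto simp: open_map_def openin_open_subtopology op)
  show "f ` topspace (subtopology X S) = topspace (subtopology Y (f ` S))" using T by simp
  show "inj_on f (topspace (subtopology X S))" using T inj by simp
qed

section \<open>Categories, slices and unique factorisation\<close>

locale small_category =
  fixes C :: "'a cat" (structure)
  assumes category: "category C"
begin

lemma identities [simp]:
  assumes "\<alpha> \<in> mor C"
  shows "src C \<alpha> \<in> mor C" "rng C \<alpha> \<in> mor C"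
    "src C (src C \<alpha>) = src C \<alpha>" "rng C (src C \<alpha>) = src C \<alpha>"
    "src C (rng C \<alpha>) = rng C \<alpha>" "rng C (rng C \<alpha>) = rng C \<alpha>"
    "X = rng C \<alpha> \<Longrightarrow> X \<odot> \<alpha> = \<alpha>" "X = src C \<alpha> \<Longrightarrow> \<alpha> \<odot> X = \<alpha>"
  using category assms unfolding category_def by blast+

lemma composites [simp]:
  assumes "\<alpha> \<in> mor C" "\<beta> \<in> mor C" "src C \<alpha> = rng C \<beta>"
  shows "\<alpha> \<odot> \<beta> \<in> mor C" "rng C (\<alpha> \<odot> \<beta>) = rng C \<alpha>" "src C (\<alpha> \<odot> \<beta>) = src C \<beta>"
  using category assms unfolding category_def composable_def by blast+

lemma assoc:
  assumes "\<alpha> \<in> mor C" "\<beta> \<in> mor C" "\<gamma> \<in> mor C" "src C \<alpha> = rng C \<beta>" "src C \<beta> = rng C \<gamma>"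
  shows "(\<alpha> \<odot> \<beta>) \<odot> \<gamma> = \<alpha> \<odot> (\<beta> \<odot> \<gamma>)"
  using category assms unfolding category_def composable_def by blast

lemma objD [simp]:
  assumes "X \<in> obj C"
  shows "X \<in> mor C" "src C X = X" "rng C X = X"
  using assms identities(4)[of X] unfolding obj_def by auto

lemma src_rng_obj [simp]:
  assumes "\<alpha> \<in> mor C"
  shows "src C \<alpha> \<in> obj C" "rng C \<alpha> \<in> obj C"
  using assms unfolding obj_def by auto

lemma slice_mor_iff:
  "(\<alpha>, \<gamma>) \<in> mor (slice C X) \<longleftrightarrow> \<alpha> \<in> mor C \<and> rng C \<alpha> = X \<and> \<gamma> \<in> mor C \<and> src C \<alpha> = rng C \<gamma>"
  unfolding slice_def into_def composable_def by auto

lemma slice_simps: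
  "src (slice C X) (\<alpha>, \<gamma>) = (\<alpha> \<odot> \<gamma>, src C \<gamma>)"
  "rng (slice C X) (\<alpha>, \<gamma>) = (\<alpha>, src C \<alpha>)"
  "cmp (slice C X) (\<alpha>, \<gamma>) (\<beta>, \<delta>) = (\<alpha>, \<gamma> \<odot> \<delta>)"
  unfolding slice_def by auto

lemma category_slice: "category (slice C X)"
  unfolding category_def
  by (auto simp: slice_mor_iff slice_simps composable_def assoc)

end

locale KP_fibration =
  fixes E :: "'e cat" (structure) and B :: "'b cat" and F :: "'e \<Rightarrow> 'b"
  assumes KP: "Kumjian_Pask_fibration E B F"
begin

lemma is_functor: "is_functor E B F"
  using KP unfolding Kumjian_Pask_fibration_def discrete_Conduche_fibration_def by blast

sublocale E: small_category E
  using is_functor by unfold_locales (simp add: is_functor_def)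

sublocale B: small_category B
  using is_functor by unfold_locales (simp add: is_functor_def)

lemma F_simps [simp]:
  assumes "\<alpha> \<in> mor E"
  shows "F \<alpha> \<in> mor B" "F (src E \<alpha>) = src B (F \<alpha>)" "F (rng E \<alpha>) = rng B (F \<alpha>)"
  using is_functor assms unfolding is_functor_def by blast+

lemma F_obj [simp]:
  assumes "X \<in> obj E"
  shows "F X \<in> obj B"
  using F_simps(1,2)[of X] assms unfolding obj_def by (metis (mono_tags) mem_Collect_eq)

lemma F_cmp [simp]:
  assumes "\<alpha> \<in> mor E" "\<beta> \<in> mor E" "src E \<alpha> = rng E \<beta>"
  shows "F (\<alpha> \<odot> \<beta>) = F \<alpha> \<odot>\<^bsub>B\<^esub> F \<beta>"
  using is_functor assms unfolding is_functor_def composable_def by blast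

lemma F_composable:
  assumes "\<alpha> \<in> mor E" "\<beta> \<in> mor E" "src E \<alpha> = rng E \<beta>"
  shows "src B (F \<alpha>) = rng B (F \<beta>)"
  using assms by (metis F_simps(2,3))

lemma factorisation_exists:
  assumes "\<phi> \<in> mor E" "\<rho> \<in> mor B" "\<kappa> \<in> mor B" "src B \<rho> = rng B \<kappa>" "F \<phi> = \<rho> \<odot>\<^bsub>B\<^esub> \<kappa>"
  obtains \<rho>' \<kappa>' where "\<rho>' \<in> mor E" "\<kappa>' \<in> mor E" "src E \<rho>' = rng E \<kappa>'" "\<phi> = \<rho>' \<odot> \<kappa>'"
    "F \<rho>' = \<rho>" "F \<kappa>' = \<kappa>"
proof -
  have "\<exists>!p. case p of (\<rho>', \<kappa>') \<Rightarrow>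
           composable E \<rho>' \<kappa>' \<and> \<phi> = \<rho>' \<odot> \<kappa>' \<and> F \<rho>' = \<rho> \<and> F \<kappa>' = \<kappa>"
    using KP assms
    unfolding Kumjian_Pask_fibration_def discrete_Conduche_fibration_def composable_def by blast
  then show thesis using that unfolding composable_def by blast
qed

lemma factorisation_unique:
  assumes "\<rho> \<in> mor E" "\<kappa> \<in> mor E" "src E \<rho> = rng E \<kappa>"
    and "\<rho>' \<in> mor E" "\<kappa>' \<in> mor E" "src E \<rho>' = rng E \<kappa>'"
    and "\<rho> \<odot> \<kappa> = \<rho>' \<odot> \<kappa>'" "F \<rho> = F \<rho>'" "F \<kappa> = F \<kappa>'"
  shows "\<rho> = \<rho>'" "\<kappa> = \<kappa>'"
proof -
  let ?P = "\<lambda>p. case p of (\<alpha>, \<beta>) \<Rightarrow>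
           composable E \<alpha> \<beta> \<and> \<rho> \<odot> \<kappa> = \<alpha> \<odot> \<beta> \<and> F \<alpha> = F \<rho> \<and> F \<beta> = F \<kappa>"
  have *: "\<rho> \<odot> \<kappa> \<in> mor E" "composable B (F \<rho>) (F \<kappa>)" "F (\<rho> \<odot> \<kappa>) = F \<rho> \<odot>\<^bsub>B\<^esub> F \<kappa>"
    using assms(1-3) F_composable[OF assms(1-3)] by (simp_all add: composable_def)
  have "\<exists>!p. ?P p"
    using KP *
    unfolding Kumjian_Pask_fibration_def discrete_Conduche_fibration_def by blast
  moreover have "?P (\<rho>, \<kappa>)" "?P (\<rho>', \<kappa>')"
    using assms(1-6) assms(7-9)[symmetric] by (simp_all add: composable_def)
  ultimately have "(\<rho>, \<kappa>) = (\<rho>', \<kappa>')" by blast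
  then show "\<rho> = \<rho>'" "\<kappa> = \<kappa>'" by auto
qed

text \<open>The trivial factorisations \<open>\<alpha> = r(\<alpha>)\<alpha> = \<alpha>s(\<alpha>)\<close> of a morphism over an identity lie over the
  same factorisation, so they agree.\<close>

lemma lift_of_identity:
  assumes \<alpha>: "\<alpha> \<in> mor E" and id: "rng B (F \<alpha>) = F \<alpha>"
  shows "rng E \<alpha> = \<alpha>"
proof -
  have "src B (F \<alpha>) = F \<alpha>" using B.identities(5)[of "F \<alpha>"] \<alpha> id by (metis F_simps(1))
  then show ?thesis
    using \<alpha> id by (intro factorisation_unique(1)[of "rng E \<alpha>" \<alpha> \<alpha> "src E \<alpha>"]) simp_all
qed

lemma Ore:
  assumes "m \<in> mor B" "n \<in> mor B" "rng B m = rng B n"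
  obtains p q where "p \<in> mor B" "q \<in> mor B" "src B m = rng B p" "src B n = rng B q"
    "m \<odot>\<^bsub>B\<^esub> p = n \<odot>\<^bsub>B\<^esub> q"
  using KP assms
  unfolding Kumjian_Pask_fibration_def strongly_right_Ore_def right_Ore_def
    completes_cospan_def composable_def by meson

lemma strong_Ore:
  assumes "completes_cospan B m n p q" "completes_cospan B m n p' q'"
  obtains a b where "completes_cospan B p p' a b" "completes_cospan B q q' a b"
proof -
  have "rng B m = rng B n" "m \<in> mor B" "n \<in> mor B"
    using assms(1) unfolding completes_cospan_def composable_def by (metis B.composites(2))+
  then show thesis
    using KP assms that unfolding Kumjian_Pask_fibration_def strongly_right_Ore_def by meson
qed

section \<open>Infinite paths as coherent families of morphisms\<close>

abbreviation "paths \<equiv> paths_to E B F"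
abbreviation "Z \<equiv> cyl E B F"
abbreviation "val \<equiv> path_at B"
abbreviation "step \<equiv> path_step"

lemma paths_toD:
  assumes "x \<in> paths X"
  shows "fst x = X" "slice_section E B F X (snd x)" "snd x \<in> extensional (mor (slice B (F X)))"
  using assms unfolding paths_to_def by auto

text \<open>The morphism \<open>(a, b)\<close> of the slice runs from the object \<open>ab\<close> to the object \<open>a\<close>. Comparing its image with
  the images of these two objects gives \<open>x\<^sub>1(a, b) = x(a)\<close> and \<open>x(a)x\<^sub>2(a, b) = x(ab)\<close>.\<close>

lemma path_facts:
  assumes X: "X \<in> obj E" and x: "x \<in> paths X"
    and a: "a \<in> mor B" "rng B a = F X" and b: "b \<in> mor B" "src B a = rng B b"
  shows "step x a b \<in> mor E"
    and "rng E (step x a b) = src E (val x a)"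
    and "F (step x a b) = b"
    and "val x a \<odot> step x a b = val x (a \<odot>\<^bsub>B\<^esub> b)"
    and "val x a \<in> mor E" "rng E (val x a) = X" "F (val x a) = a"
    and "snd x (a, b) = (val x a, step x a b)"
proof -
  let ?S = "slice B (F X)" and ?T = "slice E X"
  have m: "(a, b) \<in> mor ?S" using a b by (simp add: B.slice_mor_iff)
  have f: "is_functor ?S ?T (snd x)" and
    F: "map_prod F F (snd x (a, b)) = (a, b)"
    using paths_toD(2)[OF x] m unfolding slice_section_def by blast+
  obtain \<alpha> \<gamma> where e: "snd x (a, b) = (\<alpha>, \<gamma>)" by fastforce
  have "snd x (a, b) \<in> mor ?T" "snd x (src ?S (a, b)) = src ?T (snd x (a, b))"
    "snd x (rng ?S (a, b)) = rng ?T (snd x (a, b))"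
    using f m unfolding is_functor_def by blast+
  then have *: "\<alpha> \<in> mor E" "rng E \<alpha> = X" "\<gamma> \<in> mor E" "src E \<alpha> = rng E \<gamma>"
    "snd x (a \<odot>\<^bsub>B\<^esub> b, src B b) = (\<alpha> \<odot> \<gamma>, src E \<gamma>)" "snd x (a, src B a) = (\<alpha>, src E \<alpha>)"
    by (auto simp: e E.slice_mor_iff E.slice_simps B.slice_simps)
  have \<alpha>: "val x a = \<alpha>" "step x a b = \<gamma>" "val x (a \<odot>\<^bsub>B\<^esub> b) = \<alpha> \<odot> \<gamma>"
    using * a b unfolding path_at_def path_step_def by (auto simp: e)
  show "step x a b \<in> mor E" "rng E (step x a b) = src E (val x a)" "F (step x a b) = b"
    "val x a \<odot> step x a b = val x (a \<odot>\<^bsub>B\<^esub> b)"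
    "val x a \<in> mor E" "rng E (val x a) = X" "F (val x a) = a"
    "snd x (a, b) = (val x a, step x a b)"
    using * F by (auto simp: \<alpha> e)
qed

lemma path_at_mor [simp]:
  assumes "X \<in> obj E" "x \<in> paths X" "a \<in> mor B" "rng B a = F X"
  shows "val x a \<in> mor E" "rng E (val x a) = X" "F (val x a) = a"
  using path_facts(5-7)[OF assms, of "src B a"] assms by auto

lemma path_step_unique:
  assumes "X \<in> obj E" "x \<in> paths X" "a \<in> mor B" "rng B a = F X"
    and "\<gamma> \<in> mor E" "rng E \<gamma> = src E (val x a)" "val x (a \<odot>\<^bsub>B\<^esub> F \<gamma>) = val x a \<odot> \<gamma>"
  shows "step x a (F \<gamma>) = \<gamma>"
proof -
  have "src B a = rng B (F \<gamma>)"
    using F_composable[of "val x a" \<gamma>] assms by simp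
  note s = path_facts[OF assms(1-4) _ this]
  show ?thesis
    using s assms
    by (intro factorisation_unique(2)[of "val x a" "step x a (F \<gamma>)" "val x a" \<gamma>]) simp_all
qed

text \<open>The value of a path at \<open>ab\<close> determines its value at \<open>a\<close>, as the left factor over \<open>a\<close>.\<close>

lemma path_at_prefix:
  assumes "X \<in> obj E" "x \<in> paths X" "a \<in> mor B" "rng B a = F X" "b \<in> mor B" "src B a = rng B b"
    and "\<rho> \<in> mor E" "\<kappa> \<in> mor E" "src E \<rho> = rng E \<kappa>" "val x (a \<odot>\<^bsub>B\<^esub> b) = \<rho> \<odot> \<kappa>" "F \<rho> = a" "F \<kappa> = b"
  shows "val x a = \<rho>" "step x a b = \<kappa>"
proof -
  note s = path_facts[OF assms(1-6)]
  show "val x a = \<rho>"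
    using s assms by (intro factorisation_unique(1)[of "val x a" "step x a b" \<rho> \<kappa>]) simp_all
  show "step x a b = \<kappa>"
    using s assms by (intro factorisation_unique(2)[of "val x a" "step x a b" \<rho> \<kappa>]) simp_all
qed

lemma path_eqI:
  assumes X: "X \<in> obj E" and x: "x \<in> paths X" and y: "y \<in> paths X"
    and eq: "\<And>a. a \<in> mor B \<Longrightarrow> rng B a = F X \<Longrightarrow> val x a = val y a"
  shows "x = y"
proof -
  have "snd x m = snd y m" if "m \<in> mor (slice B (F X))" for m
  proof -
    obtain a b where m: "m = (a, b)" by fastforce
    then have ab: "a \<in> mor B" "rng B a = F X" "b \<in> mor B" "src B a = rng B b"
      using that by (auto simp: B.slice_mor_iff)
    note p = path_facts[OF X x ab] and q = path_facts[OF X y ab]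
    have "step x a b = step y a b"
      using path_step_unique[OF X x ab(1,2), of "step y a b"] p q ab eq by simp
    then show ?thesis using p q eq ab m by simp
  qed
  then have "snd x = snd y"
    using paths_toD(3)[OF x] paths_toD(3)[OF y] by (rule extensionalityI[rotated 2])
  then show ?thesis using paths_toD(1)[OF x] paths_toD(1)[OF y] by (simp add: prod_eq_iff)
qed

text \<open>This characterises the object parts of infinite paths.\<close>

definition coherent :: "'e \<Rightarrow> ('b \<Rightarrow> 'e) \<Rightarrow> bool" where
  "coherent X f \<longleftrightarrow>
     (\<forall>a. a \<in> mor B \<and> rng B a = F X \<longrightarrow> f a \<in> mor E \<and> rng E (f a) = X \<and> F (f a) = a) \<and>
     (\<forall>a b. a \<in> mor B \<and> rng B a = F X \<and> b \<in> mor B \<and> src B a = rng B b \<longrightarrow>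
        (\<exists>\<gamma>\<in>mor E. src E (f a) = rng E \<gamma> \<and> F \<gamma> = b \<and> f (a \<odot>\<^bsub>B\<^esub> b) = f a \<odot> \<gamma>))"

text \<open>By unique factorisation the connecting morphisms of a coherent family are determined and
  compose, hence the family is the object part of a functor.\<close>

lemma coherent_path:
  assumes X: "X \<in> obj E" and f: "coherent X f"
  obtains x where "x \<in> paths X" "\<And>a. a \<in> mor B \<Longrightarrow> rng B a = F X \<Longrightarrow> val x a = f a"
proof -
  define g where "g a b = (SOME \<gamma>. \<gamma> \<in> mor E \<and> src E (f a) = rng E \<gamma> \<and> F \<gamma> = b \<and>
    f (a \<odot>\<^bsub>B\<^esub> b) = f a \<odot> \<gamma>)" for a b
  have f1: "f a \<in> mor E" "rng E (f a) = X" "F (f a) = a" if "a \<in> mor B" "rng B a = F X" for a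
    using f that unfolding coherent_def by blast+
  have g1: "g a b \<in> mor E" "src E (f a) = rng E (g a b)" "F (g a b) = b"
    "f (a \<odot>\<^bsub>B\<^esub> b) = f a \<odot> g a b"
    if "a \<in> mor B" "rng B a = F X" "b \<in> mor B" "src B a = rng B b" for a b
  proof -
    have "\<exists>\<gamma>. \<gamma> \<in> mor E \<and> src E (f a) = rng E \<gamma> \<and> F \<gamma> = b \<and> f (a \<odot>\<^bsub>B\<^esub> b) = f a \<odot> \<gamma>"
      using f that unfolding coherent_def by blast
    from someI_ex[OF this, folded g_def]
    show "g a b \<in> mor E" "src E (f a) = rng E (g a b)" "F (g a b) = b"
    "f (a \<odot>\<^bsub>B\<^esub> b) = f a \<odot> g a b" by blast+
  qed
  have g2: "g a b = \<gamma>"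
    if "a \<in> mor B" "rng B a = F X" "b \<in> mor B" "src B a = rng B b"
      "\<gamma> \<in> mor E" "src E (f a) = rng E \<gamma>" "F \<gamma> = b" "f (a \<odot>\<^bsub>B\<^esub> b) = f a \<odot> \<gamma>" for a b \<gamma>
    using g1[OF that(1-4)] that f1[OF that(1,2)]
    by (intro factorisation_unique(2)[of "f a" "g a b" "f a" \<gamma>]) simp_all
  have g3: "g a (src B a) = src E (f a)" if "a \<in> mor B" "rng B a = F X" for a
    using that f1[OF that] F_simps(2)[of "f a"] by (intro g2) simp_all
  have g4: "g a (b \<odot>\<^bsub>B\<^esub> c) = g a b \<odot> g (a \<odot>\<^bsub>B\<^esub> b) c"
    if "a \<in> mor B" "rng B a = F X" "b \<in> mor B" "src B a = rng B b" "c \<in> mor B" "src B b = rng B c"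
    for a b c
  proof (intro g2)
    have ab: "a \<odot>\<^bsub>B\<^esub> b \<in> mor B" "rng B (a \<odot>\<^bsub>B\<^esub> b) = F X" "src B (a \<odot>\<^bsub>B\<^esub> b) = rng B c"
      using that by simp_all
    note h = g1[OF that(1-4)] f1[OF that(1,2)] and h' = g1[OF ab(1,2) that(5) ab(3)]
    have "src E (g a b) = src E (f (a \<odot>\<^bsub>B\<^esub> b))" unfolding h(4) using h(1,2,5) by simp
    then have s: "src E (g a b) = rng E (g (a \<odot>\<^bsub>B\<^esub> b) c)" using h'(2) by simp
    show "g a b \<odot> g (a \<odot>\<^bsub>B\<^esub> b) c \<in> mor E" "src E (f a) = rng E (g a b \<odot> g (a \<odot>\<^bsub>B\<^esub> b) c)"
      "F (g a b \<odot> g (a \<odot>\<^bsub>B\<^esub> b) c) = b \<odot>\<^bsub>B\<^esub> c" using h(1-3) h'(1,3) s by simp_all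
    have "f (a \<odot>\<^bsub>B\<^esub> (b \<odot>\<^bsub>B\<^esub> c)) = (f a \<odot> g a b) \<odot> g (a \<odot>\<^bsub>B\<^esub> b) c"
      using B.assoc[OF that(1,3,5,4,6)] h(4) h'(4) by simp
    then show "f (a \<odot>\<^bsub>B\<^esub> (b \<odot>\<^bsub>B\<^esub> c)) = f a \<odot> (g a b \<odot> g (a \<odot>\<^bsub>B\<^esub> b) c)"
      using E.assoc[OF h(5,1) h'(1) h(2) s] by simp
  qed (use that in simp_all)
  define x where "x = (X, restrict (\<lambda>(a, b). (f a, g a b)) (mor (slice B (F X))))"
  have ev: "snd x (a, b) = (f a, g a b)"
    if "a \<in> mor B" "rng B a = F X" "b \<in> mor B" "src B a = rng B b" for a b
    using that by (simp add: x_def B.slice_mor_iff)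
  have "is_functor (slice B (F X)) (slice E X) (snd x)"
    unfolding is_functor_def
  proof (intro conjI ballI allI impI)
    fix m assume "m \<in> mor (slice B (F X))"
    then obtain a b where m: "m = (a, b)" and
      ab: "a \<in> mor B" "rng B a = F X" "b \<in> mor B" "src B a = rng B b"
      by (cases m) (auto simp: B.slice_mor_iff)
    note h = f1[OF ab(1,2)] g1[OF ab]
    show "snd x m \<in> mor (slice E X)" using h m by (simp add: ev[OF ab] E.slice_mor_iff)
    have "g (a \<odot>\<^bsub>B\<^esub> b) (src B b) = src E (g a b)"
      using g3[of "a \<odot>\<^bsub>B\<^esub> b"] ab E.composites(3)[OF h(1,4,5)] unfolding h(7) by simp
    then show "snd x (src (slice B (F X)) m) = src (slice E X) (snd x m)"
      using h m ab by (simp add: B.slice_simps E.slice_simps ev)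
    show "snd x (rng (slice B (F X)) m) = rng (slice E X) (snd x m)"
      using h m ab g3[OF ab(1,2)] by (simp add: B.slice_simps E.slice_simps ev)
  next
    fix m n assume "composable (slice B (F X)) m n"
    then obtain a b c where m: "m = (a, b)" "n = (a \<odot>\<^bsub>B\<^esub> b, c)" and
      ab: "a \<in> mor B" "rng B a = F X" "b \<in> mor B" "src B a = rng B b" "c \<in> mor B" "src B b = rng B c"
      by (cases m, cases n) (auto simp: composable_def B.slice_mor_iff B.slice_simps)
    show "snd x (m \<odot>\<^bsub>slice B (F X)\<^esub> n) = snd x m \<odot>\<^bsub>slice E X\<^esub> snd x n"
      using ab by (simp add: m B.slice_simps E.slice_simps ev g4)
  qed (rule B.category_slice E.category_slice)+
  moreover have "map_prod F F (snd x m) = m" if "m \<in> mor (slice B (F X))" for m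
    using that by (cases m) (auto simp: B.slice_mor_iff ev f1 g1)
  ultimately have "x \<in> paths X"
    unfolding paths_to_def slice_section_def by (simp add: x_def)
  moreover have "val x a = f a" if "a \<in> mor B" "rng B a = F X" for a
    using that by (simp add: path_at_def ev)
  ultimately show thesis using that by blast
qed

text \<open>Both sides complete \<open>x(a)\<close> to \<open>x(abc)\<close> over the same factorisation of \<open>abc\<close>.\<close>

lemma path_step_cocycle:
  assumes X: "X \<in> obj E" and x: "x \<in> paths X"
    and a: "a \<in> mor B" "rng B a = F X" and b: "b \<in> mor B" "src B a = rng B b"
    and c: "c \<in> mor B" "src B b = rng B c"
  shows "step x a (b \<odot>\<^bsub>B\<^esub> c) = step x a b \<odot> step x (a \<odot>\<^bsub>B\<^esub> b) c"
    and "src E (step x a b) = rng E (step x (a \<odot>\<^bsub>B\<^esub> b) c)"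
proof -
  have ab: "a \<odot>\<^bsub>B\<^esub> b \<in> mor B" "rng B (a \<odot>\<^bsub>B\<^esub> b) = F X" "src B (a \<odot>\<^bsub>B\<^esub> b) = rng B c"
    using a b c by simp_all
  note h = path_facts[OF X x a b] and h' = path_facts[OF X x ab(1,2) c(1) ab(3)]
  have "src E (step x a b) = src E (val x a \<odot> step x a b)" using h(1,2,5) by simp
  also have "\<dots> = rng E (step x (a \<odot>\<^bsub>B\<^esub> b) c)" using h(4) h'(2) by simp
  finally show s: "src E (step x a b) = rng E (step x (a \<odot>\<^bsub>B\<^esub> b) c)" .
  have "val x (a \<odot>\<^bsub>B\<^esub> (b \<odot>\<^bsub>B\<^esub> c)) = (val x a \<odot> step x a b) \<odot> step x (a \<odot>\<^bsub>B\<^esub> b) c"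
    using h'(4) h(4) B.assoc[OF a(1) b(1) c(1) b(2) c(2)] by simp
  also have "\<dots> = val x a \<odot> (step x a b \<odot> step x (a \<odot>\<^bsub>B\<^esub> b) c)"
    using E.assoc[OF h(5,1) h'(1)] h(2) s by simp
  finally show "step x a (b \<odot>\<^bsub>B\<^esub> c) = step x a b \<odot> step x (a \<odot>\<^bsub>B\<^esub> b) c"
    using path_step_unique[OF X x a, of "step x a b \<odot> step x (a \<odot>\<^bsub>B\<^esub> b) c"] h(1-3) h'(1,3) s
    by simp
qed

section \<open>Cylinders and shifts\<close>

lemma cylD:
  assumes "x \<in> Z \<mu>"
  shows "x \<in> paths (rng E \<mu>)" "val x (F \<mu>) = \<mu>"
  using assms unfolding cyl_def by auto

text \<open>A section need not send the object \<open>F(X)\<close> to \<open>X\<close> by definition; it does so here because identities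
  have only identities above them. Hence \<open>Z(X)\<close> consists of all paths to \<open>X\<close>.\<close>

lemma path_at_object:
  assumes "X \<in> obj E" "x \<in> paths X"
  shows "val x (F X) = X"
proof -
  have F: "F X \<in> obj B" using assms by simp
  have "rng E (val x (F X)) = val x (F X)"
    using path_at_mor[OF assms, of "F X"] F by (intro lift_of_identity) simp_all
  then show ?thesis using path_at_mor[OF assms, of "F X"] F by simp
qed

lemma cyl_object: "X \<in> obj E \<Longrightarrow> Z X = paths X"
  using path_at_object unfolding cyl_def by auto

lemma cyl_step:
  assumes "\<mu> \<in> mor E" "x \<in> Z \<mu>" "a \<in> mor B" "src B (F \<mu>) = rng B a"
  shows "step x (F \<mu>) a \<in> mor E" "rng E (step x (F \<mu>) a) = src E \<mu>" "F (step x (F \<mu>) a) = a"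
    "val x (F \<mu> \<odot>\<^bsub>B\<^esub> a) = \<mu> \<odot> step x (F \<mu>) a"
  using path_facts[OF _ cylD(1)[OF assms(2)] _ _ assms(3,4)] cylD(2)[OF assms(2)] assms(1)
  by simp_all

lemma cyl_mult_iff:
  assumes "\<mu> \<in> mor E" "\<gamma> \<in> mor E" "src E \<mu> = rng E \<gamma>"
  shows "x \<in> Z (\<mu> \<odot> \<gamma>) \<longleftrightarrow> x \<in> Z \<mu> \<and> step x (F \<mu>) (F \<gamma>) = \<gamma>"
proof
  assume x: "x \<in> Z (\<mu> \<odot> \<gamma>)"
  then have p: "x \<in> paths (rng E \<mu>)" "val x (F \<mu> \<odot>\<^bsub>B\<^esub> F \<gamma>) = \<mu> \<odot> \<gamma>"
    using cylD[OF x] assms by simp_all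
  have "val x (F \<mu>) = \<mu>" "step x (F \<mu>) (F \<gamma>) = \<gamma>"
    using p assms F_composable[OF assms]
    by (intro path_at_prefix[of "rng E \<mu>" x "F \<mu>" "F \<gamma>" \<mu> \<gamma>]; simp)+
  then show "x \<in> Z \<mu> \<and> step x (F \<mu>) (F \<gamma>) = \<gamma>" using p unfolding cyl_def by simp
next
  assume x: "x \<in> Z \<mu> \<and> step x (F \<mu>) (F \<gamma>) = \<gamma>"
  then have "x \<in> Z \<mu>" ..
  from cylD[OF this] cyl_step(4)[OF assms(1) this _ F_composable[OF assms]] x
  show "x \<in> Z (\<mu> \<odot> \<gamma>)" unfolding cyl_def using assms by simp
qed

text \<open>The two legs of the completed square have the same composite \<open>c\<close>, and the single value \<open>x(c)\<close> extends both
  \<open>\<mu>\<close> and \<open>\<nu>\<close>.\<close>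

lemma cyl_refine:
  assumes \<mu>: "\<mu> \<in> mor E" "x \<in> Z \<mu>" and \<nu>: "\<nu> \<in> mor E" "x \<in> Z \<nu>"
    and ab: "completes_cospan B (F \<mu>) (F \<nu>) a b"
  shows "step x (F \<mu>) a \<in> mor E" "rng E (step x (F \<mu>) a) = src E \<mu>"
    "step x (F \<nu>) b \<in> mor E" "rng E (step x (F \<nu>) b) = src E \<nu>"
    "\<mu> \<odot> step x (F \<mu>) a = \<nu> \<odot> step x (F \<nu>) b"
    "x \<in> Z (\<mu> \<odot> step x (F \<mu>) a)"
proof -
  have ab: "a \<in> mor B" "src B (F \<mu>) = rng B a" "b \<in> mor B" "src B (F \<nu>) = rng B b"
    "F \<mu> \<odot>\<^bsub>B\<^esub> a = F \<nu> \<odot>\<^bsub>B\<^esub> b"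
    using ab unfolding completes_cospan_def composable_def by auto
  note h = cyl_step[OF \<mu> ab(1,2)] and h' = cyl_step[OF \<nu> ab(3,4)]
  show "step x (F \<mu>) a \<in> mor E" "rng E (step x (F \<mu>) a) = src E \<mu>"
    "step x (F \<nu>) b \<in> mor E" "rng E (step x (F \<nu>) b) = src E \<nu>"
    "\<mu> \<odot> step x (F \<mu>) a = \<nu> \<odot> step x (F \<nu>) b"
    using h h' ab(5) by simp_all
  show "x \<in> Z (\<mu> \<odot> step x (F \<mu>) a)" using cyl_mult_iff[of \<mu> "step x (F \<mu>) a" x] h \<mu> by simp
qed

lemma cyl_rng_eq:
  assumes "x \<in> Z \<mu>" "x \<in> Z \<nu>"
  shows "rng E \<mu> = rng E \<nu>"
  using cylD(1)[THEN paths_toD(1)] assms by metis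

lemma common_refinement:
  assumes "\<mu> \<in> mor E" "x \<in> Z \<mu>" "\<nu> \<in> mor E" "x \<in> Z \<nu>"
  obtains \<gamma> \<eta> where "\<gamma> \<in> mor E" "src E \<mu> = rng E \<gamma>" "\<eta> \<in> mor E" "src E \<nu> = rng E \<eta>"
    "\<mu> \<odot> \<gamma> = \<nu> \<odot> \<eta>" "x \<in> Z (\<mu> \<odot> \<gamma>)"
proof -
  have "rng B (F \<mu>) = rng B (F \<nu>)" using cyl_rng_eq[OF assms(2,4)] assms by (metis F_simps(3))
  then obtain a b where "completes_cospan B (F \<mu>) (F \<nu>) a b"
    using Ore[of "F \<mu>" "F \<nu>"] assms unfolding completes_cospan_def composable_def
    by (metis F_simps(1))
  from cyl_refine[OF assms this] that show thesis by metis
qed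

abbreviation "Res \<equiv> res E B F"
abbreviation "Ind \<equiv> ind E B F"

text \<open>The tails \<open>x\<^sub>2(F(\<mu>), a)\<close> form a coherent family by the cocycle identity. The path it gives is the shift
  of \<open>x\<close>, since the connecting morphisms \<open>x\<^sub>2(F(\<mu>)a, b)\<close> are the only possible ones.\<close>

lemma
  assumes \<mu>: "\<mu> \<in> mor E" and x: "x \<in> Z \<mu>"
  shows res_in_paths: "Res \<mu> x \<in> paths (src E \<mu>)"
    and val_res: "\<And>a. a \<in> mor B \<Longrightarrow> rng B a = src B (F \<mu>) \<Longrightarrow> val (Res \<mu> x) a = step x (F \<mu>) a"
proof -
  let ?f = "\<lambda>a. step x (F \<mu>) a"
  note px = cylD[OF x]
  have X: "rng E \<mu> \<in> obj E" "rng B (F \<mu>) = F (rng E \<mu>)" "src E \<mu> \<in> obj E" using \<mu> by simp_all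
  have co: "?f (a \<odot>\<^bsub>B\<^esub> b) = ?f a \<odot> step x (F \<mu> \<odot>\<^bsub>B\<^esub> a) b \<and>
      src E (?f a) = rng E (step x (F \<mu> \<odot>\<^bsub>B\<^esub> a) b) \<and> step x (F \<mu> \<odot>\<^bsub>B\<^esub> a) b \<in> mor E \<and>
      F (step x (F \<mu> \<odot>\<^bsub>B\<^esub> a) b) = b"
    if "a \<in> mor B" "rng B a = src B (F \<mu>)" "b \<in> mor B" "src B a = rng B b" for a b
  proof -
    have m: "F \<mu> \<in> mor B" "F \<mu> \<odot>\<^bsub>B\<^esub> a \<in> mor B" "rng B (F \<mu> \<odot>\<^bsub>B\<^esub> a) = F (rng E \<mu>)"
      "src B (F \<mu> \<odot>\<^bsub>B\<^esub> a) = rng B b" using that \<mu> by simp_all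
    show ?thesis
      using path_step_cocycle[OF X(1) px(1) m(1) X(2) that(1) that(2)[symmetric] that(3,4)]
        path_facts[OF X(1) px(1) m(2,3) that(3) m(4)] by simp
  qed
  have "coherent (src E \<mu>) ?f"
    unfolding coherent_def
  proof (intro conjI allI impI; elim conjE)
    fix a assume "a \<in> mor B" "rng B a = F (src E \<mu>)"
    then show "?f a \<in> mor E" "rng E (?f a) = src E \<mu>" "F (?f a) = a"
      using cyl_step[OF \<mu> x, of a] \<mu> by simp_all
  next
    fix a b assume "a \<in> mor B" "rng B a = F (src E \<mu>)" "b \<in> mor B" "src B a = rng B b"
    then show "\<exists>\<gamma>\<in>mor E. src E (?f a) = rng E \<gamma> \<and> F \<gamma> = b \<and> ?f (a \<odot>\<^bsub>B\<^esub> b) = ?f a \<odot> \<gamma>"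
      using co[of a b] \<mu> by (intro bexI[of _ "step x (F \<mu> \<odot>\<^bsub>B\<^esub> a) b"]) simp_all
  qed
  then obtain y where y: "y \<in> paths (src E \<mu>)"
    and vy: "\<And>a. a \<in> mor B \<Longrightarrow> rng B a = F (src E \<mu>) \<Longrightarrow> val y a = ?f a"
    using coherent_path X(3) by metis
  have "snd (Res \<mu> x) = snd y"
  proof (rule extensionalityI)
    show "snd (Res \<mu> x) \<in> extensional (mor (slice B (F (src E \<mu>))))"
      unfolding res_def by simp
    show "snd y \<in> extensional (mor (slice B (F (src E \<mu>))))" using y by (rule paths_toD)
    fix m assume m: "m \<in> mor (slice B (F (src E \<mu>)))"
    obtain a b where mab: "m = (a, b)" by fastforce
    then have ab: "a \<in> mor B" "rng B a = F (src E \<mu>)" "b \<in> mor B" "src B a = rng B b"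
      using m by (auto simp: B.slice_mor_iff)
    have ab': "a \<odot>\<^bsub>B\<^esub> b \<in> mor B" "rng B (a \<odot>\<^bsub>B\<^esub> b) = F (src E \<mu>)" using ab by simp_all
    have r: "rng B a = src B (F \<mu>)" using ab \<mu> by simp
    note c = co[OF ab(1) r ab(3,4)]
    have "step y a (F (step x (F \<mu> \<odot>\<^bsub>B\<^esub> a) b)) = step x (F \<mu> \<odot>\<^bsub>B\<^esub> a) b"
      using c vy[OF ab(1,2)] vy[OF ab'] by (intro path_step_unique[OF X(3) y ab(1,2)]) simp_all
    then have "step y a b = step x (F \<mu> \<odot>\<^bsub>B\<^esub> a) b" using c by simp
    then show "snd (Res \<mu> x) m = snd y m"
      using path_facts(8)[OF X(3) y ab] m vy[OF ab(1,2)] by (simp add: res_def mab)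
  qed
  then have e: "Res \<mu> x = y" using paths_toD(1)[OF y] by (simp add: res_def prod_eq_iff)
  show "Res \<mu> x \<in> paths (src E \<mu>)" using e y by simp
  show "val (Res \<mu> x) a = step x (F \<mu>) a" if "a \<in> mor B" "rng B a = src B (F \<mu>)" for a
    using e vy[of a] that \<mu> by simp
qed

lemma val_mult_res:
  assumes "\<mu> \<in> mor E" "x \<in> Z \<mu>" "a \<in> mor B" "rng B a = src B (F \<mu>)"
  shows "val x (F \<mu> \<odot>\<^bsub>B\<^esub> a) = \<mu> \<odot> val (Res \<mu> x) a"
  using cyl_step(4)[OF assms(1-3)] val_res[OF assms] assms(4) by simp

lemma cyl_mult_res_iff:
  assumes "\<mu> \<in> mor E" "\<gamma> \<in> mor E" "src E \<mu> = rng E \<gamma>"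
  shows "x \<in> Z (\<mu> \<odot> \<gamma>) \<longleftrightarrow> x \<in> Z \<mu> \<and> Res \<mu> x \<in> Z \<gamma>"
proof -
  have "Res \<mu> x \<in> Z \<gamma> \<longleftrightarrow> step x (F \<mu>) (F \<gamma>) = \<gamma>" if "x \<in> Z \<mu>"
    using val_res[OF assms(1) that, of "F \<gamma>"] res_in_paths[OF assms(1) that] assms
      F_composable[OF assms] unfolding cyl_def by simp
  then show ?thesis using cyl_mult_iff[OF assms] by blast
qed

lemma res_mult:
  assumes \<mu>: "\<mu> \<in> mor E" "\<gamma> \<in> mor E" "src E \<mu> = rng E \<gamma>" and x: "x \<in> Z (\<mu> \<odot> \<gamma>)"
  shows "Res (\<mu> \<odot> \<gamma>) x = Res \<gamma> (Res \<mu> x)"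
proof -
  have x': "x \<in> Z \<mu>" "Res \<mu> x \<in> Z \<gamma>" using x cyl_mult_res_iff[OF \<mu>] by auto
  have c: "src B (F \<mu>) = rng B (F \<gamma>)" by (rule F_composable[OF \<mu>])
  show ?thesis
  proof (rule path_eqI)
    show "src E \<gamma> \<in> obj E" using \<mu> by simp
    show "Res (\<mu> \<odot> \<gamma>) x \<in> paths (src E \<gamma>)" using res_in_paths[OF _ x] \<mu> by simp
    show "Res \<gamma> (Res \<mu> x) \<in> paths (src E \<gamma>)" using res_in_paths[OF \<mu>(2) x'(2)] .
    fix a assume a: "a \<in> mor B" "rng B a = F (src E \<gamma>)"
    have "val (Res (\<mu> \<odot> \<gamma>) x) a = step x (F \<mu> \<odot>\<^bsub>B\<^esub> F \<gamma>) a"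
      using val_res[OF _ x, of a] \<mu> a c by simp
    also have "\<dots> = step (Res \<mu> x) (F \<gamma>) a"
    proof -
      let ?s = "step x (F \<mu> \<odot>\<^bsub>B\<^esub> F \<gamma>) a"
      have s: "?s \<in> mor E" "rng E ?s = src E \<gamma>" "F ?s = a"
        using cyl_step[OF _ x, of a] \<mu> a c by simp_all
      have "val (Res \<mu> x) (F \<gamma> \<odot>\<^bsub>B\<^esub> a) = step x (F \<mu>) (F \<gamma> \<odot>\<^bsub>B\<^esub> a)"
        using val_res[OF \<mu>(1) x'(1), of "F \<gamma> \<odot>\<^bsub>B\<^esub> a"] \<mu> a c by simp
      also have "\<dots> = \<gamma> \<odot> ?s"
        using path_step_cocycle(1)[of "rng E \<mu>" x "F \<mu>" "F \<gamma>" a] cylD[OF x'(1)] \<mu> a c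
          cyl_mult_iff[OF \<mu>] x by simp
      finally have "step (Res \<mu> x) (F \<gamma>) (F ?s) = ?s"
        using path_step_unique[of "rng E \<gamma>" "Res \<mu> x" "F \<gamma>" ?s] s cylD[OF x'(2)] \<mu> by simp
      then show ?thesis using s by simp
    qed
    also have "\<dots> = val (Res \<gamma> (Res \<mu> x)) a"
      using val_res[OF \<mu>(2) x'(2), of a] \<mu> a by simp
    finally show "val (Res (\<mu> \<odot> \<gamma>) x) a = val (Res \<gamma> (Res \<mu> x)) a" .
  qed
qed

lemma res_object:
  assumes "X \<in> obj E" "x \<in> paths X"
  shows "Res X x = x"
proof -
  have x: "x \<in> Z X" using assms cyl_object by simp
  have F: "F X \<in> obj B" using assms by simp
  show ?thesis
  proof (rule path_eqI[OF assms(1) _ assms(2)])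
    show "Res X x \<in> paths X" using res_in_paths[of X x] x assms by simp
    fix a assume a: "a \<in> mor B" "rng B a = F X"
    have "val x (F X \<odot>\<^bsub>B\<^esub> a) = X \<odot> val (Res X x) a"
      using val_mult_res[of X x a] assms x a F by simp
    then show "val (Res X x) a = val x a"
      using a F assms path_at_mor[of X "Res X x" a] res_in_paths[of X x] x by simp
  qed
qed

text \<open>By the Ore condition every \<open>c\<close> has a multiple in \<open>F(\<mu>)\<B>\<close>, and the values of a path at the
  multiples of \<open>F(\<mu>)\<close> are read off from the shifted path.\<close>

lemma res_inj:
  assumes \<mu>: "\<mu> \<in> mor E" and x: "x \<in> Z \<mu>" and y: "y \<in> Z \<mu>" and eq: "Res \<mu> x = Res \<mu> y"
  shows "x = y"
proof (rule path_eqI)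
  show X: "rng E \<mu> \<in> obj E" and px: "x \<in> paths (rng E \<mu>)" and py: "y \<in> paths (rng E \<mu>)"
    using \<mu> cylD[OF x] cylD[OF y] by simp_all
  fix c assume c: "c \<in> mor B" "rng B c = F (rng E \<mu>)"
  obtain p q where pq: "p \<in> mor B" "q \<in> mor B" "src B c = rng B p" "src B (F \<mu>) = rng B q"
    "c \<odot>\<^bsub>B\<^esub> p = F \<mu> \<odot>\<^bsub>B\<^esub> q"
    using Ore[of c "F \<mu>"] c \<mu> by (metis F_simps(1,3))
  note h = path_facts[OF X py c pq(1,3)]
  have "val x (c \<odot>\<^bsub>B\<^esub> p) = val y c \<odot> step y c p"
    using h(4) val_mult_res[OF \<mu> x, of q] val_mult_res[OF \<mu> y, of q] pq eq by simp
  then show "val x c = val y c"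
    using path_at_prefix(1)[OF X px c pq(1,3), of "val y c" "step y c p"] h by simp
qed

text \<open>The value at \<open>c\<close> of the path to be constructed must be the left factor over \<open>cp = F(\<mu>)q\<close> of
  \<open>\<mu> y(q)\<close>. Two completions \<open>(p, q)\<close> of the cospan become equal after a further extension, because
  the base is strongly right Ore; so this left factor does not depend on the choice.\<close>

lemma res_surj:
  assumes \<mu>: "\<mu> \<in> mor E" and y: "y \<in> paths (src E \<mu>)"
  obtains x where "x \<in> Z \<mu>" "Res \<mu> x = y"
proof -
  let ?X = "rng E \<mu>"
  have S: "src E \<mu> \<in> obj E" "?X \<in> obj E" using \<mu> by simp_all
  \<comment> \<open>\<open>R c \<rho>\<close>: some completion of the cospan \<open>c, F(\<mu>)\<close> prescribes the value \<open>\<rho>\<close> at \<open>c\<close>.\<close>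
  define R where "R c \<rho> \<longleftrightarrow> (\<exists>p q \<kappa>. completes_cospan B c (F \<mu>) p q \<and> \<rho> \<in> mor E \<and> \<kappa> \<in> mor E \<and>
    src E \<rho> = rng E \<kappa> \<and> \<rho> \<odot> \<kappa> = \<mu> \<odot> val y q \<and> F \<rho> = c \<and> F \<kappa> = p)" for c \<rho>
  have vy: "val y q \<in> mor E" "rng E (val y q) = src E \<mu>" "F (val y q) = q"
    if "completes_cospan B c (F \<mu>) p q" for c p q
    using that path_at_mor[OF S(1) y, of q] \<mu> unfolding completes_cospan_def composable_def
    by simp_all
  have R_unique: "\<rho> = \<rho>'" if r: "R c \<rho>" "R c \<rho>'" for c \<rho> \<rho>'
  proof -
    obtain p q \<kappa> where 1: "completes_cospan B c (F \<mu>) p q" "\<rho> \<in> mor E" "\<kappa> \<in> mor E"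
      "src E \<rho> = rng E \<kappa>" "\<rho> \<odot> \<kappa> = \<mu> \<odot> val y q" "F \<rho> = c" "F \<kappa> = p"
      using r(1) unfolding R_def by blast
    obtain p' q' \<kappa>' where 2: "completes_cospan B c (F \<mu>) p' q'" "\<rho>' \<in> mor E" "\<kappa>' \<in> mor E"
      "src E \<rho>' = rng E \<kappa>'" "\<rho>' \<odot> \<kappa>' = \<mu> \<odot> val y q'" "F \<rho>' = c" "F \<kappa>' = p'"
      using r(2) unfolding R_def by blast
    obtain a b where ab: "completes_cospan B p p' a b" "completes_cospan B q q' a b"
      using strong_Ore[OF 1(1) 2(1)] .
    have ext: "\<exists>\<sigma>\<in>mor E. src E \<kappa> = rng E \<sigma> \<and> F \<sigma> = a \<and> \<rho> \<odot> (\<kappa> \<odot> \<sigma>) = \<mu> \<odot> val y (q \<odot>\<^bsub>B\<^esub> a)"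
      if 1: "completes_cospan B c (F \<mu>) p q" "\<rho> \<in> mor E" "\<kappa> \<in> mor E" "src E \<rho> = rng E \<kappa>"
        "\<rho> \<odot> \<kappa> = \<mu> \<odot> val y q" and a: "composable B q a" for p q \<rho> \<kappa> a
    proof -
      have q: "q \<in> mor B" "rng B q = F (src E \<mu>)" "a \<in> mor B" "src B q = rng B a"
        using 1 a \<mu> unfolding completes_cospan_def composable_def by simp_all
      note v = vy[OF 1(1)] and h = path_facts[OF S(1) y q]
      let ?s = "step y q a"
      have "src E \<kappa> = src E (\<rho> \<odot> \<kappa>)" using 1(2-4) by simp
      also have "\<dots> = rng E ?s" unfolding 1(5) using v h \<mu> by simp
      finally have s: "src E \<kappa> = rng E ?s" .
      have "\<rho> \<odot> (\<kappa> \<odot> ?s) = (\<rho> \<odot> \<kappa>) \<odot> ?s" using 1(2-4) s h(1) E.assoc by simp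
      also have "\<dots> = \<mu> \<odot> (val y q \<odot> ?s)" unfolding 1(5) using v h \<mu> E.assoc by simp
      finally show ?thesis using h s by (intro bexI[of _ ?s]) simp_all
    qed
    obtain \<sigma> where \<sigma>: "\<sigma> \<in> mor E" "src E \<kappa> = rng E \<sigma>" "F \<sigma> = a"
      "\<rho> \<odot> (\<kappa> \<odot> \<sigma>) = \<mu> \<odot> val y (q \<odot>\<^bsub>B\<^esub> a)"
      using ext[OF 1(1-5), of a] ab(2) unfolding completes_cospan_def by blast
    obtain \<sigma>' where \<sigma>': "\<sigma>' \<in> mor E" "src E \<kappa>' = rng E \<sigma>'" "F \<sigma>' = b"
      "\<rho>' \<odot> (\<kappa>' \<odot> \<sigma>') = \<mu> \<odot> val y (q' \<odot>\<^bsub>B\<^esub> b)"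
      using ext[OF 2(1-5), of b] ab(2) unfolding completes_cospan_def by blast
    have e: "q \<odot>\<^bsub>B\<^esub> a = q' \<odot>\<^bsub>B\<^esub> b" "p \<odot>\<^bsub>B\<^esub> a = p' \<odot>\<^bsub>B\<^esub> b"
      using ab unfolding completes_cospan_def by simp_all
    show ?thesis
      by (rule factorisation_unique(1)[of \<rho> "\<kappa> \<odot> \<sigma>" \<rho>' "\<kappa>' \<odot> \<sigma>'"]) (use 1 2 \<sigma> \<sigma>' e in simp_all)
  qed
  have cos: "R c \<rho> \<Longrightarrow> \<rho> \<in> mor E \<and> rng E \<rho> = ?X \<and> F \<rho> = c" for c \<rho>
    unfolding R_def using vy \<mu> by (metis E.composites(2))
  have R_exists: "\<exists>\<rho> \<gamma>. R c \<rho> \<and> R (c \<odot>\<^bsub>B\<^esub> d) (\<rho> \<odot> \<gamma>) \<and> \<gamma> \<in> mor E \<and> src E \<rho> = rng E \<gamma> \<and> F \<gamma> = d"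
    if c: "c \<in> mor B" "rng B c = F ?X" and d: "d \<in> mor B" "src B c = rng B d" for c d
  proof -
    have cd: "c \<odot>\<^bsub>B\<^esub> d \<in> mor B" "rng B (c \<odot>\<^bsub>B\<^esub> d) = rng B (F \<mu>)" "src B (c \<odot>\<^bsub>B\<^esub> d) = src B d"
      using c d \<mu> by simp_all
    obtain p q where pq: "p \<in> mor B" "q \<in> mor B" "src B d = rng B p" "src B (F \<mu>) = rng B q"
      "(c \<odot>\<^bsub>B\<^esub> d) \<odot>\<^bsub>B\<^esub> p = F \<mu> \<odot>\<^bsub>B\<^esub> q"
      using Ore[OF cd(1) _ cd(2)] cd(3) \<mu> by (metis F_simps(1))
    have 1: "completes_cospan B (c \<odot>\<^bsub>B\<^esub> d) (F \<mu>) p q"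
      using cd pq \<mu> unfolding completes_cospan_def composable_def by simp
    have 2: "completes_cospan B c (F \<mu>) (d \<odot>\<^bsub>B\<^esub> p) q"
      using c d pq \<mu> B.assoc[of c d p] unfolding completes_cospan_def composable_def by simp
    note v = vy[OF 1]
    have m: "\<mu> \<odot> val y q \<in> mor E" "F (\<mu> \<odot> val y q) = (c \<odot>\<^bsub>B\<^esub> d) \<odot>\<^bsub>B\<^esub> p" using v \<mu> pq by simp_all
    obtain \<rho>' \<kappa> where f: "\<rho>' \<in> mor E" "\<kappa> \<in> mor E" "src E \<rho>' = rng E \<kappa>" "\<mu> \<odot> val y q = \<rho>' \<odot> \<kappa>"
      "F \<rho>' = c \<odot>\<^bsub>B\<^esub> d" "F \<kappa> = p"
      using factorisation_exists[OF m(1) cd(1) pq(1) _ m(2)] cd(3) pq(3) by metis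
    obtain \<rho> \<gamma> where g: "\<rho> \<in> mor E" "\<gamma> \<in> mor E" "src E \<rho> = rng E \<gamma>" "\<rho>' = \<rho> \<odot> \<gamma>" "F \<rho> = c" "F \<gamma> = d"
      using factorisation_exists[OF f(1) c(1) d f(5)] .
    have k: "src E \<gamma> = rng E \<kappa>" using f(3) g by simp
    have "R (c \<odot>\<^bsub>B\<^esub> d) (\<rho> \<odot> \<gamma>)" unfolding R_def using 1 f g(4) by metis
    moreover have "\<rho> \<odot> (\<gamma> \<odot> \<kappa>) = \<mu> \<odot> val y q" unfolding f(4) g(4) using g(1-3) f(2) k E.assoc by simp
    then have "R c \<rho>" unfolding R_def
      using 2 f(2,6) g(1-3,5,6) k
      by (intro exI[of _ "d \<odot>\<^bsub>B\<^esub> p"] exI[of _ q] exI[of _ "\<gamma> \<odot> \<kappa>"]) simp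
    ultimately show ?thesis using g by blast
  qed
  define f where "f c = (THE \<rho>. R c \<rho>)" for c
  have fI: "f c = \<rho>" if "R c \<rho>" for c \<rho>
    unfolding f_def using that R_unique by blast
  have "coherent ?X f"
    unfolding coherent_def
  proof (intro conjI allI impI; elim conjE)
    fix a assume "a \<in> mor B" "rng B a = F ?X"
    then obtain \<rho> where "R a \<rho>" using R_exists[of a "src B a"] by auto
    then show "f a \<in> mor E" "rng E (f a) = ?X" "F (f a) = a" using fI cos by simp_all
  next
    fix a b assume "a \<in> mor B" "rng B a = F ?X" "b \<in> mor B" "src B a = rng B b"
    then obtain \<rho> \<gamma> where "R a \<rho>" "R (a \<odot>\<^bsub>B\<^esub> b) (\<rho> \<odot> \<gamma>)" "\<gamma> \<in> mor E" "src E \<rho> = rng E \<gamma>" "F \<gamma> = b"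
      using R_exists[of a b] by blast
    then show "\<exists>\<gamma>\<in>mor E. src E (f a) = rng E \<gamma> \<and> F \<gamma> = b \<and> f (a \<odot>\<^bsub>B\<^esub> b) = f a \<odot> \<gamma>"
      using fI by blast
  qed
  then obtain x where x: "x \<in> paths ?X"
    and vx: "\<And>a. a \<in> mor B \<Longrightarrow> rng B a = F ?X \<Longrightarrow> val x a = f a"
    using coherent_path[OF S(2)] by metis
  have ext: "val x (F \<mu> \<odot>\<^bsub>B\<^esub> a) = \<mu> \<odot> val y a" if a: "a \<in> mor B" "rng B a = src B (F \<mu>)" for a
  proof -
    note v = path_at_mor[OF S(1) y a(1)]
    have "R (F \<mu> \<odot>\<^bsub>B\<^esub> a) (\<mu> \<odot> val y a)"
      unfolding R_def completes_cospan_def composable_def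
      by (intro exI[of _ "src B a"] exI[of _ a] exI[of _ "src E (val y a)"])
        (use v \<mu> a in simp)
    then show ?thesis using vx[of "F \<mu> \<odot>\<^bsub>B\<^esub> a"] fI a \<mu> by simp
  qed
  have "val x (F \<mu>) = \<mu>"
    using ext[of "src B (F \<mu>)"] path_at_object[OF S(1) y] \<mu> by simp
  then have Z: "x \<in> Z \<mu>" using x unfolding cyl_def by simp
  have "Res \<mu> x = y"
  proof (rule path_eqI[OF S(1) res_in_paths[OF \<mu> Z] y])
    fix a assume "a \<in> mor B" "rng B a = F (src E \<mu>)"
    then have a: "a \<in> mor B" "rng B a = F (src E \<mu>)" "rng B a = src B (F \<mu>)" using \<mu> by simp_all
    note v = path_at_mor[OF S(1) y a(1,2)]
    have "step x (F \<mu>) (F (val y a)) = val y a"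
      by (rule path_step_unique[OF S(2) x]) (use \<mu> v cylD(2)[OF Z] ext[OF a(1,3)] in simp_all)
    then show "val (Res \<mu> x) a = val y a" using val_res[OF \<mu> Z a(1,3)] v by simp
  qed
  with Z that show thesis by blast
qed

lemma
  assumes \<mu>: "\<mu> \<in> mor E" and y: "y \<in> paths (src E \<mu>)"
  shows ind_in_cyl: "Ind \<mu> y \<in> Z \<mu>" and res_ind: "Res \<mu> (Ind \<mu> y) = y"
proof -
  have "y \<in> Res \<mu> ` Z \<mu>" using res_surj[OF \<mu> y] by blast
  then show "Ind \<mu> y \<in> Z \<mu>" "Res \<mu> (Ind \<mu> y) = y"
    unfolding ind_def by (rule inv_into_into, rule f_inv_into_f)
qed

lemma ind_res:
  assumes "\<mu> \<in> mor E" "x \<in> Z \<mu>" "Res \<mu> x = y"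
  shows "Ind \<mu> y = x"
  using res_inj[OF assms(1)] assms(2) unfolding ind_def assms(3)[symmetric]
  by (intro inv_into_f_f inj_onI)

section \<open>The equivalence relation on triples\<close>

abbreviation "transport \<mu> \<nu> x \<equiv> Ind \<mu> (Res \<nu> x)"

lemma triples_iff:
  "(\<mu>, \<nu>, x) \<in> triples E B F \<longleftrightarrow> \<mu> \<in> mor E \<and> \<nu> \<in> mor E \<and> src E \<mu> = src E \<nu> \<and> x \<in> Z \<nu>"
  unfolding triples_def by auto

lemma transport:
  assumes "(\<mu>, \<nu>, x) \<in> triples E B F"
  shows "transport \<mu> \<nu> x \<in> Z \<mu>" "Res \<mu> (transport \<mu> \<nu> x) = Res \<nu> x"
proof -
  have "Res \<nu> x \<in> paths (src E \<mu>)" using assms res_in_paths[of \<nu> x] by (simp add: triples_iff)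
  then show "transport \<mu> \<nu> x \<in> Z \<mu>" "Res \<mu> (transport \<mu> \<nu> x) = Res \<nu> x"
    using assms ind_in_cyl[of \<mu> "Res \<nu> x"] res_ind[of \<mu> "Res \<nu> x"] by (simp_all add: triples_iff)
qed

lemma triple_swap:
  assumes "(\<mu>, \<nu>, x) \<in> triples E B F"
  shows "(\<nu>, \<mu>, transport \<mu> \<nu> x) \<in> triples E B F" "transport \<nu> \<mu> (transport \<mu> \<nu> x) = x"
proof -
  show "(\<nu>, \<mu>, transport \<mu> \<nu> x) \<in> triples E B F"
    using transport[OF assms] assms unfolding triples_iff by simp
  show "transport \<nu> \<mu> (transport \<mu> \<nu> x) = x"
    using transport(2)[OF assms, symmetric] assms unfolding triples_iff by (intro ind_res) auto
qed

text \<open>Replacing \<open>\<nu>\<gamma>\<close> by \<open>\<mu>\<gamma>\<close> is replacing \<open>\<nu>\<close> by \<open>\<mu>\<close>: the next segment \<open>\<gamma>\<close> of the path is common to both sides.\<close>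

lemma triple_extend:
  assumes "(\<mu>, \<nu>, x) \<in> triples E B F" "\<gamma> \<in> mor E" "src E \<nu> = rng E \<gamma>" "Res \<nu> x \<in> Z \<gamma>"
  shows "(\<mu> \<odot> \<gamma>, \<nu> \<odot> \<gamma>, x) \<in> triples E B F" "transport (\<mu> \<odot> \<gamma>) (\<nu> \<odot> \<gamma>) x = transport \<mu> \<nu> x"
proof -
  have t: "\<mu> \<in> mor E" "\<nu> \<in> mor E" "src E \<mu> = src E \<nu>" "x \<in> Z \<nu>" "src E \<mu> = rng E \<gamma>"
    using assms(1,3) by (simp_all add: triples_iff)
  let ?z = "transport \<mu> \<nu> x"
  note z = transport[OF assms(1)]
  have x: "x \<in> Z (\<nu> \<odot> \<gamma>)" using cyl_mult_res_iff[OF t(2) assms(2,3)] assms(4) t(4) by simp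
  show "(\<mu> \<odot> \<gamma>, \<nu> \<odot> \<gamma>, x) \<in> triples E B F" using x t assms(2,3) unfolding triples_iff by simp
  have z': "?z \<in> Z (\<mu> \<odot> \<gamma>)" using cyl_mult_res_iff[OF t(1) assms(2) t(5)] assms(4) z by simp
  have "Res (\<mu> \<odot> \<gamma>) ?z = Res (\<nu> \<odot> \<gamma>) x"
    using res_mult[OF t(1) assms(2) t(5) z'] res_mult[OF t(2) assms(2,3) x] z(2) by simp
  then show "transport (\<mu> \<odot> \<gamma>) (\<nu> \<odot> \<gamma>) x = ?z"
    using z' t(1,5) assms(2) by (intro ind_res) simp_all
qed

text \<open>This is equality of the formal fractions \<open>m n\<^sup>-\<^sup>1\<close> and \<open>m' n'\<^sup>-\<^sup>1\<close>, where \<open>m, n\<close> have a common domain.\<close>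

definition same_degree :: "'b \<Rightarrow> 'b \<Rightarrow> 'b \<Rightarrow> 'b \<Rightarrow> bool" where
  "same_degree m n m' n' \<longleftrightarrow> (\<exists>a b. completes_cospan B m m' a b \<and> completes_cospan B n n' a b)"

lemma same_degree_refl: "m \<in> mor B \<Longrightarrow> n \<in> mor B \<Longrightarrow> src B m = src B n \<Longrightarrow> same_degree m n m n"
  unfolding same_degree_def completes_cospan_def composable_def
  by (intro exI[of _ "src B m"]) simp

lemma same_degree_sym: "same_degree m n m' n' \<Longrightarrow> same_degree m' n' m n"
  unfolding same_degree_def completes_cospan_def by metis

lemma same_degree_swap: "same_degree m n m' n' \<Longrightarrow> same_degree n m n' m'"
  unfolding same_degree_def by blast

lemma completes_cospan_extend:
  assumes "completes_cospan B m n p q" "c \<in> mor B" "src B p = rng B c"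
  shows "completes_cospan B m n (p \<odot>\<^bsub>B\<^esub> c) (q \<odot>\<^bsub>B\<^esub> c)"
proof -
  have h: "m \<in> mor B" "n \<in> mor B" "p \<in> mor B" "q \<in> mor B" "src B m = rng B p" "src B n = rng B q"
    "m \<odot>\<^bsub>B\<^esub> p = n \<odot>\<^bsub>B\<^esub> q" using assms(1) unfolding completes_cospan_def composable_def by auto
  have "src B q = rng B c" using h assms(3) B.composites(3) by metis
  then show ?thesis
    using h assms(2,3) B.assoc[of m p c] B.assoc[of n q c]
    unfolding completes_cospan_def composable_def by simp
qed

lemma completes_cospan_trans:
  assumes "completes_cospan B m n p q" "completes_cospan B n l q r"
  shows "completes_cospan B m l p r"
  using assms unfolding completes_cospan_def composable_def by simp

text \<open>The two witnesses meet in the middle fraction and are matched by completing the cospan they form.\<close>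

lemma same_degree_trans:
  assumes 1: "same_degree m n m' n'" and 2: "same_degree m' n' m'' n''"
  shows "same_degree m n m'' n''"
proof -
  obtain a b where ab: "completes_cospan B m m' a b" "completes_cospan B n n' a b"
    using 1 unfolding same_degree_def by blast
  obtain c d where cd: "completes_cospan B m' m'' c d" "completes_cospan B n' n'' c d"
    using 2 unfolding same_degree_def by blast
  have bc: "b \<in> mor B" "c \<in> mor B" "rng B b = rng B c"
    using ab(1) cd(1) unfolding completes_cospan_def composable_def by auto
  obtain p q where pq: "p \<in> mor B" "q \<in> mor B" "src B b = rng B p" "src B c = rng B q"
    "b \<odot>\<^bsub>B\<^esub> p = c \<odot>\<^bsub>B\<^esub> q" using Ore[OF bc] .
  have "src B a = src B b" using ab(1) unfolding completes_cospan_def composable_def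
    by (metis B.composites(3))
  then have ap: "src B a = rng B p" using pq(3) by simp
  note e = completes_cospan_extend
  have "completes_cospan B m m'' (a \<odot>\<^bsub>B\<^esub> p) (d \<odot>\<^bsub>B\<^esub> q)"
    using completes_cospan_trans e[OF ab(1) pq(1) ap] e[OF cd(1) pq(2,4)] pq(5) by metis
  moreover have "completes_cospan B n n'' (a \<odot>\<^bsub>B\<^esub> p) (d \<odot>\<^bsub>B\<^esub> q)"
    using completes_cospan_trans e[OF ab(2) pq(1) ap] e[OF cd(2) pq(2,4)] pq(5) by metis
  ultimately show ?thesis unfolding same_degree_def by blast
qed

text \<open>Degrees behave like fractions: the completions given by the two hypotheses complete the same
  cospan, and the strong Ore condition makes them equal after a further extension.\<close>

lemma same_degree_mult:
  assumes 1: "same_degree m k m' k'" and 2: "same_degree k n k' n'"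
  shows "same_degree m n m' n'"
proof -
  obtain a b where ab: "completes_cospan B m m' a b" "completes_cospan B k k' a b"
    using 1 unfolding same_degree_def by blast
  obtain c d where cd: "completes_cospan B k k' c d" "completes_cospan B n n' c d"
    using 2 unfolding same_degree_def by blast
  obtain p q where pq: "completes_cospan B a c p q" "completes_cospan B b d p q"
    using strong_Ore[OF ab(2) cd(1)] .
  have h: "p \<in> mor B" "src B a = rng B p" "q \<in> mor B" "src B c = rng B q"
    "a \<odot>\<^bsub>B\<^esub> p = c \<odot>\<^bsub>B\<^esub> q" "b \<odot>\<^bsub>B\<^esub> p = d \<odot>\<^bsub>B\<^esub> q"
    using pq unfolding completes_cospan_def composable_def by auto
  have "completes_cospan B m m' (a \<odot>\<^bsub>B\<^esub> p) (b \<odot>\<^bsub>B\<^esub> p)"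
    by (rule completes_cospan_extend[OF ab(1) h(1,2)])
  moreover have "completes_cospan B n n' (a \<odot>\<^bsub>B\<^esub> p) (b \<odot>\<^bsub>B\<^esub> p)"
    unfolding h(5,6) by (rule completes_cospan_extend[OF cd(2) h(3,4)])
  ultimately show ?thesis unfolding same_degree_def by blast
qed

lemma same_degree_extend:
  assumes "\<mu> \<in> mor E" "\<nu> \<in> mor E" "\<gamma> \<in> mor E" "src E \<mu> = rng E \<gamma>" "src E \<nu> = rng E \<gamma>"
  shows "same_degree (F \<mu>) (F \<nu>) (F (\<mu> \<odot> \<gamma>)) (F (\<nu> \<odot> \<gamma>))"
  unfolding same_degree_def completes_cospan_def composable_def
  using assms F_composable[of \<mu> \<gamma>] F_composable[of \<nu> \<gamma>]
  by (intro exI[of _ "F \<gamma>"] exI[of _ "src B (F \<gamma>)"]) simp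

text \<open>The tail \<open>x\<^sub>2(F(\<nu>), a)\<close> is also a tail of the transported path, which lies in \<open>Z(\<mu>)\<close>; so a
  common extension of the degrees lifts simultaneously along both paths.\<close>

lemma common_extension:
  assumes t: "(\<mu>, \<nu>, x) \<in> triples E B F" and t': "(\<mu>', \<nu>', x) \<in> triples E B F"
    and eq: "transport \<mu> \<nu> x = transport \<mu>' \<nu>' x" and d: "same_degree (F \<mu>) (F \<nu>) (F \<mu>') (F \<nu>')"
  obtains \<gamma> \<gamma>' where "\<gamma> \<in> mor E" "\<gamma>' \<in> mor E" "src E \<nu> = rng E \<gamma>" "src E \<nu>' = rng E \<gamma>'"
    "\<mu> \<odot> \<gamma> = \<mu>' \<odot> \<gamma>'" "\<nu> \<odot> \<gamma> = \<nu>' \<odot> \<gamma>'" "x \<in> Z (\<nu> \<odot> \<gamma>)"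
proof -
  obtain a b where ab: "completes_cospan B (F \<mu>) (F \<mu>') a b" "completes_cospan B (F \<nu>) (F \<nu>') a b"
    using d unfolding same_degree_def by blast
  let ?z = "transport \<mu> \<nu> x"
  have m: "\<mu> \<in> mor E" "\<mu>' \<in> mor E" "\<nu> \<in> mor E" "\<nu>' \<in> mor E" "x \<in> Z \<nu>" "x \<in> Z \<nu>'"
    using t t' unfolding triples_iff by simp_all
  note z = transport[OF t] transport[OF t', folded eq]
  note r = cyl_refine[OF m(3,5,4,6) ab(2)] and q = cyl_refine[OF m(1) z(1) m(2) z(3) ab(1)]
  have c: "a \<in> mor B" "b \<in> mor B" "rng B a = src B (F \<mu>)" "rng B a = src B (F \<nu>)"
    "rng B b = src B (F \<mu>')" "rng B b = src B (F \<nu>')"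
    using ab unfolding completes_cospan_def composable_def by simp_all
  have "step ?z (F \<mu>) a = step x (F \<nu>) a"
    using val_res[OF m(1) z(1) c(1,3)] val_res[OF m(3,5) c(1,4)] z(2) by simp
  moreover have "step ?z (F \<mu>') b = step x (F \<nu>') b"
    using val_res[OF m(2) z(3) c(2,5)] val_res[OF m(4,6) c(2,6)] z(4) by simp
  ultimately have "\<mu> \<odot> step x (F \<nu>) a = \<mu>' \<odot> step x (F \<nu>') b" using q(5) by simp
  then show thesis using that r by metis
qed

abbreviation "rel \<equiv> triple_rel E B F"
abbreviation "cls \<equiv> tclass E B F"

text \<open>The local condition in the definition of the relation may be tested at the single point \<open>x\<close>:
  by the preceding lemma equality there extends to a cylinder.\<close>

lemma rel_iff:
  "((\<mu>, \<nu>, x), (\<mu>', \<nu>', x')) \<in> rel \<longleftrightarrow>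
     (\<mu>, \<nu>, x) \<in> triples E B F \<and> (\<mu>', \<nu>', x') \<in> triples E B F \<and> x = x' \<and>
     transport \<mu> \<nu> x = transport \<mu>' \<nu>' x' \<and> same_degree (F \<mu>) (F \<nu>) (F \<mu>') (F \<nu>')"
  (is "?L \<longleftrightarrow> ?R")
proof
  assume ?L
  then show ?R unfolding triple_rel_def same_degree_def by auto
next
  assume ?R
  then have t: "(\<mu>, \<nu>, x) \<in> triples E B F" "(\<mu>', \<nu>', x) \<in> triples E B F" "x = x'"
    "transport \<mu> \<nu> x = transport \<mu>' \<nu>' x" and d: "same_degree (F \<mu>) (F \<nu>) (F \<mu>') (F \<nu>')" by auto
  obtain \<gamma> \<gamma>' where g: "\<gamma> \<in> mor E" "\<gamma>' \<in> mor E" "src E \<nu> = rng E \<gamma>" "src E \<nu>' = rng E \<gamma>'"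
    "\<mu> \<odot> \<gamma> = \<mu>' \<odot> \<gamma>'" "\<nu> \<odot> \<gamma> = \<nu>' \<odot> \<gamma>'" "x \<in> Z (\<nu> \<odot> \<gamma>)"
    using common_extension[OF t(1,2,4) d] .
  have m: "\<nu> \<in> mor E" "\<nu>' \<in> mor E" "\<nu> \<odot> \<gamma> \<in> mor E" using t g(1,3) unfolding triples_iff by simp_all
  have "y \<in> Z \<nu> \<and> y \<in> Z \<nu>' \<and> transport \<mu> \<nu> y = transport \<mu>' \<nu>' y" if y: "y \<in> Z (\<nu> \<odot> \<gamma>)" for y
  proof -
    have y1: "y \<in> Z \<nu>" "Res \<nu> y \<in> Z \<gamma>"
      using y cyl_mult_res_iff[OF m(1) g(1,3)] by auto
    have y2: "y \<in> Z \<nu>'" "Res \<nu>' y \<in> Z \<gamma>'"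
      using y cyl_mult_res_iff[OF m(2) g(2,4)] unfolding g(6) by auto
    have ty: "(\<mu>, \<nu>, y) \<in> triples E B F" "(\<mu>', \<nu>', y) \<in> triples E B F"
      using t y1 y2 unfolding triples_iff by simp_all
    have "transport (\<mu> \<odot> \<gamma>) (\<nu> \<odot> \<gamma>) y = transport \<mu>' \<nu>' y"
      unfolding g(5,6) by (rule triple_extend[OF ty(2) g(2,4) y2(2)])
    then show ?thesis using triple_extend(2)[OF ty(1) g(1,3) y1(2)] y1 y2 by simp
  qed
  then have "\<exists>\<kappa>\<in>mor E. x \<in> Z \<kappa> \<and> Z \<kappa> \<subseteq> Z \<nu> \<inter> Z \<nu>' \<and>
      (\<forall>y\<in>Z \<kappa>. transport \<mu> \<nu> y = transport \<mu>' \<nu>' y)"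
    using m(3) g(7) by (intro bexI[of _ "\<nu> \<odot> \<gamma>"]) auto
  then show ?L using t d unfolding triple_rel_def same_degree_def by blast
qed

lemma equiv_rel: "equiv (triples E B F) rel"
proof (rule equivI)
  show "rel \<subseteq> triples E B F \<times> triples E B F" unfolding triple_rel_def by auto
  show "refl_on (triples E B F) rel"
    by (rule refl_onI) (auto simp: rel_iff triples_iff intro!: same_degree_refl; metis F_simps(2))
  show "sym rel" by (rule symI) (auto simp: rel_iff intro: same_degree_sym)
  show "trans rel" by (rule transI) (auto simp: rel_iff intro: same_degree_trans)
qed

lemma mem_cls_iff: "(\<mu>', \<nu>', x') \<in> cls \<mu> \<nu> x \<longleftrightarrow> ((\<mu>, \<nu>, x), (\<mu>', \<nu>', x')) \<in> rel"
  unfolding tclass_def by simp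

lemma cls_eq_iff:
  assumes "(\<mu>, \<nu>, x) \<in> triples E B F" "(\<mu>', \<nu>', x') \<in> triples E B F"
  shows "cls \<mu> \<nu> x = cls \<mu>' \<nu>' x' \<longleftrightarrow> ((\<mu>, \<nu>, x), (\<mu>', \<nu>', x')) \<in> rel"
  unfolding tclass_def by (rule eq_equiv_class_iff[OF equiv_rel assms])

lemma mem_cls_self: "(\<mu>, \<nu>, x) \<in> triples E B F \<Longrightarrow> (\<mu>, \<nu>, x) \<in> cls \<mu> \<nu> x"
  unfolding tclass_def using equiv_class_self[OF equiv_rel] .

lemma cls_extend:
  assumes "(\<mu>, \<nu>, x) \<in> triples E B F" "\<gamma> \<in> mor E" "src E \<nu> = rng E \<gamma>" "Res \<nu> x \<in> Z \<gamma>"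
  shows "cls (\<mu> \<odot> \<gamma>) (\<nu> \<odot> \<gamma>) x = cls \<mu> \<nu> x"
proof -
  have "same_degree (F \<mu>) (F \<nu>) (F (\<mu> \<odot> \<gamma>)) (F (\<nu> \<odot> \<gamma>))"
    using assms(1-3) by (intro same_degree_extend) (simp_all add: triples_iff)
  then show ?thesis
    using triple_extend[OF assms] assms(1) cls_eq_iff rel_iff same_degree_sym by metis
qed

section \<open>The groupoid\<close>

abbreviation "G \<equiv> KP_groupoid E B F"

lemma grng_cls:
  assumes "(\<mu>, \<nu>, x) \<in> triples E B F"
  shows "grng G (cls \<mu> \<nu> x) = transport \<mu> \<nu> x"
  unfolding KP_groupoid_def top_groupoid.simps
  by (rule the_equality, use mem_cls_self[OF assms] in blast, auto simp: mem_cls_iff rel_iff)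

lemma gsrc_cls:
  assumes "(\<mu>, \<nu>, x) \<in> triples E B F"
  shows "gsrc G (cls \<mu> \<nu> x) = x"
  unfolding KP_groupoid_def top_groupoid.simps
  by (rule the_equality, use mem_cls_self[OF assms] in blast, auto simp: mem_cls_iff rel_iff)

lemma ginv_cls:
  assumes t: "(\<mu>, \<nu>, x) \<in> triples E B F"
  shows "ginv G (cls \<mu> \<nu> x) = cls \<nu> \<mu> (transport \<mu> \<nu> x)"
  unfolding KP_groupoid_def top_groupoid.simps
proof (rule the_equality)
  fix k
  assume "\<exists>\<mu>' \<nu>' x'. (\<mu>', \<nu>', x') \<in> cls \<mu> \<nu> x \<and> k = cls \<nu>' \<mu>' (transport \<mu>' \<nu>' x')"
  then obtain \<mu>' \<nu>' where r: "((\<mu>, \<nu>, x), (\<mu>', \<nu>', x)) \<in> rel"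
    and k: "k = cls \<nu>' \<mu>' (transport \<mu>' \<nu>' x)" by (auto simp: mem_cls_iff rel_iff)
  have t': "(\<mu>', \<nu>', x) \<in> triples E B F" and z: "transport \<mu> \<nu> x = transport \<mu>' \<nu>' x"
    and d: "same_degree (F \<nu>) (F \<mu>) (F \<nu>') (F \<mu>')"
    using r same_degree_swap unfolding rel_iff by auto
  have "((\<nu>, \<mu>, transport \<mu> \<nu> x), (\<nu>', \<mu>', transport \<mu>' \<nu>' x)) \<in> rel"
    unfolding rel_iff using triple_swap[OF t] triple_swap[OF t'] z d by simp
  then show "k = cls \<nu> \<mu> (transport \<mu> \<nu> x)"
    unfolding k using cls_eq_iff triple_swap(1)[OF t] triple_swap(1)[OF t'] by metis
qed (use mem_cls_self[OF t] in blast)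

text \<open>The unit at \<open>x\<close> is given by the trivial segment \<open>r(x)\<close>, which may be extended by the segment \<open>\<nu>\<close>.\<close>

lemma gunit_eq:
  assumes \<nu>: "\<nu> \<in> mor E" and x: "x \<in> Z \<nu>"
  shows "gunit G x = cls \<nu> \<nu> x"
proof -
  have p: "x \<in> paths (rng E \<nu>)" "fst x = rng E \<nu>" using cylD(1)[OF x] paths_toD(1) by auto
  have o: "rng E \<nu> \<in> obj E" using \<nu> by simp
  have t: "(rng E \<nu>, rng E \<nu>, x) \<in> triples E B F"
    using cyl_object[OF o] p \<nu> unfolding triples_iff by simp
  have "cls (rng E \<nu> \<odot> \<nu>) (rng E \<nu> \<odot> \<nu>) x = cls (rng E \<nu>) (rng E \<nu>) x"
    using \<nu> x res_object[OF o p(1)] by (intro cls_extend[OF t]) simp_all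
  then show ?thesis using p(2) \<nu> unfolding KP_groupoid_def by simp
qed

lemma transport_trans:
  assumes "(\<mu>, \<nu>, x) \<in> triples E B F" "(\<nu>, \<tau>, y) \<in> triples E B F" "Res \<nu> x = Res \<tau> y"
  shows "(\<mu>, \<tau>, y) \<in> triples E B F" "transport \<nu> \<tau> y = x" "transport \<mu> \<tau> y = transport \<mu> \<nu> x"
  using assms ind_res[of \<nu> x] unfolding triples_iff by simp_all

lemma triples_composable:
  assumes t: "(\<mu>, \<nu>, x) \<in> triples E B F" and s: "(\<nu>, \<tau>, y) \<in> triples E B F"
    and x: "x = transport \<nu> \<tau> y"
  shows "Res \<nu> x = Res \<tau> y"
  using transport(2)[OF s] x by simp

text \<open>The fraction of the product is the product of the fractions, and the range of the product is the range of
  the first factor; neither depends on the representatives.\<close>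

lemma cls_mult_cong:
  assumes t: "(\<mu>, \<nu>, x) \<in> triples E B F" "(\<nu>, \<tau>, y) \<in> triples E B F" "Res \<nu> x = Res \<tau> y"
    and t': "(\<mu>', \<nu>', x) \<in> triples E B F" "(\<nu>', \<tau>', y) \<in> triples E B F" "Res \<nu>' x = Res \<tau>' y"
    and eq: "cls \<mu> \<nu> x = cls \<mu>' \<nu>' x" "cls \<nu> \<tau> y = cls \<nu>' \<tau>' y"
  shows "cls \<mu> \<tau> y = cls \<mu>' \<tau>' y"
proof -
  note u = transport_trans[OF t] and u' = transport_trans[OF t']
  have "transport \<mu> \<nu> x = transport \<mu>' \<nu>' x" "same_degree (F \<mu>) (F \<nu>) (F \<mu>') (F \<nu>')"
    "same_degree (F \<nu>) (F \<tau>) (F \<nu>') (F \<tau>')"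
    using eq cls_eq_iff[OF t(1) t'(1)] cls_eq_iff[OF t(2) t'(2)] unfolding rel_iff by auto
  then have "((\<mu>, \<tau>, y), (\<mu>', \<tau>', y)) \<in> rel"
    unfolding rel_iff using u u' same_degree_mult by auto
  then show ?thesis using cls_eq_iff[OF u(1) u'(1)] by simp
qed

text \<open>Completing the cospan of the inner legs extends both triples so that these legs agree.\<close>

lemma common_middle:
  assumes t: "(\<mu>, \<nu>, x) \<in> triples E B F" and s: "(\<sigma>, \<tau>, y) \<in> triples E B F"
    and x: "x = transport \<sigma> \<tau> y" and ab: "completes_cospan B (F \<nu>) (F \<sigma>) a b"
  defines "\<gamma> \<equiv> step x (F \<nu>) a" and "\<eta> \<equiv> step x (F \<sigma>) b"
  shows "(\<mu> \<odot> \<gamma>, \<nu> \<odot> \<gamma>, x) \<in> triples E B F" "(\<nu> \<odot> \<gamma>, \<tau> \<odot> \<eta>, y) \<in> triples E B F"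
    "Res (\<nu> \<odot> \<gamma>) x = Res (\<tau> \<odot> \<eta>) y"
    "cls (\<mu> \<odot> \<gamma>) (\<nu> \<odot> \<gamma>) x = cls \<mu> \<nu> x" "cls (\<nu> \<odot> \<gamma>) (\<tau> \<odot> \<eta>) y = cls \<sigma> \<tau> y"
proof -
  have m: "\<nu> \<in> mor E" "x \<in> Z \<nu>" "\<sigma> \<in> mor E" "\<tau> \<in> mor E" "src E \<sigma> = src E \<tau>"
    using t s unfolding triples_iff by simp_all
  have xs: "x \<in> Z \<sigma>" "Res \<sigma> x = Res \<tau> y" using transport[OF s] x by simp_all
  note r = cyl_refine[OF m(1,2,3) xs(1) ab, folded \<gamma>_def \<eta>_def]
  note r' = r(2)[symmetric] r(4)[symmetric]
  have g: "Res \<nu> x \<in> Z \<gamma>" using cyl_mult_res_iff[OF m(1) r(1) r'(1)] r(6) by simp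
  have h: "Res \<sigma> x \<in> Z \<eta>" using cyl_mult_res_iff[OF m(3) r(3) r'(2)] r(5,6) by simp
  have \<tau>: "src E \<tau> = rng E \<eta>" "Res \<tau> y \<in> Z \<eta>" using r'(2) m(5) h xs(2) by simp_all
  show t1: "(\<mu> \<odot> \<gamma>, \<nu> \<odot> \<gamma>, x) \<in> triples E B F" by (rule triple_extend(1)[OF t r(1) r'(1) g])
  note se = triple_extend[OF s r(3) \<tau>]
  show s1: "(\<nu> \<odot> \<gamma>, \<tau> \<odot> \<eta>, y) \<in> triples E B F" using se(1) r(5) by simp
  show "Res (\<nu> \<odot> \<gamma>) x = Res (\<tau> \<odot> \<eta>) y"
    using transport(2)[OF s1] se(2) x r(5) by simp
  show "cls (\<mu> \<odot> \<gamma>) (\<nu> \<odot> \<gamma>) x = cls \<mu> \<nu> x" by (rule cls_extend[OF t r(1) r'(1) g])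
  show "cls (\<nu> \<odot> \<gamma>) (\<tau> \<odot> \<eta>) y = cls \<sigma> \<tau> y" unfolding r(5) by (rule cls_extend[OF s r(3) \<tau>])
qed

text \<open>Every admissible choice of representatives and of a completion yields, by \<open>common_middle\<close>, a pair with
  a common middle leg, so by \<open>cls_mult_cong\<close> all choices give the same class.\<close>

lemma gmult_cls:
  assumes t: "(\<mu>, \<nu>, x) \<in> triples E B F" "(\<nu>, \<tau>, y) \<in> triples E B F" "Res \<nu> x = Res \<tau> y"
  shows "gmult G (cls \<mu> \<nu> x) (cls \<nu> \<tau> y) = cls \<mu> \<tau> y"
  unfolding KP_groupoid_def top_groupoid.simps
proof (rule the_equality)
  let ?P = "\<lambda>k \<mu>' \<nu>' x' \<sigma>' \<tau>' y' a b. (\<mu>', \<nu>', x') \<in> cls \<mu> \<nu> x \<and> (\<sigma>', \<tau>', y') \<in> cls \<nu> \<tau> y \<and>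
    x' = transport \<sigma>' \<tau>' y' \<and> completes_cospan B (F \<nu>') (F \<sigma>') a b \<and>
    k = cls (\<mu>' \<odot> step x' (F \<nu>') a) (\<tau>' \<odot> step x' (F \<sigma>') b) y'"
  have eq: "k = cls \<mu> \<tau> y" if P: "?P k \<mu>' \<nu>' x' \<sigma>' \<tau>' y' a b" for k \<mu>' \<nu>' x' \<sigma>' \<tau>' y' a b
  proof -
    have r: "((\<mu>, \<nu>, x), (\<mu>', \<nu>', x)) \<in> rel" "((\<nu>, \<tau>, y), (\<sigma>', \<tau>', y)) \<in> rel" "x' = x" "y' = y"
      and x: "x = transport \<sigma>' \<tau>' y" and ab: "completes_cospan B (F \<nu>') (F \<sigma>') a b"
      and k: "k = cls (\<mu>' \<odot> step x (F \<nu>') a) (\<tau>' \<odot> step x (F \<sigma>') b) y"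
      using P by (auto simp: mem_cls_iff rel_iff)
    have t': "(\<mu>', \<nu>', x) \<in> triples E B F" "(\<sigma>', \<tau>', y) \<in> triples E B F"
      using r unfolding rel_iff by auto
    have e: "cls \<mu> \<nu> x = cls \<mu>' \<nu>' x" "cls \<nu> \<tau> y = cls \<sigma>' \<tau>' y"
      using r cls_eq_iff[OF t(1) t'(1)] cls_eq_iff[OF t(2) t'(2)] by simp_all
    note c = common_middle[OF t' x ab]
    show ?thesis unfolding k using cls_mult_cong[OF c(1-3) t] c(4,5) e by simp
  qed
  have \<nu>: "\<nu> \<in> mor E" using t unfolding triples_iff by simp
  \<comment> \<open>For existence, complete the cospan with two equal legs by identities.\<close>
  define a where "a = src B (F \<nu>)"
  have "completes_cospan B (F \<nu>) (F \<nu>) a a"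
    unfolding completes_cospan_def composable_def a_def using \<nu> by simp
  then have P: "?P (cls (\<mu> \<odot> step x (F \<nu>) a) (\<tau> \<odot> step x (F \<nu>) a) y) \<mu> \<nu> x \<nu> \<tau> y a a"
    using mem_cls_self t transport_trans(2)[OF t] by simp
  from eq[OF this] P
  show "\<exists>\<mu>' \<nu>' x' \<sigma>' \<tau>' y' a b. ?P (cls \<mu> \<tau> y) \<mu>' \<nu>' x' \<sigma>' \<tau>' y' a b" by metis
  fix k assume "\<exists>\<mu>' \<nu>' x' \<sigma>' \<tau>' y' a b. ?P k \<mu>' \<nu>' x' \<sigma>' \<tau>' y' a b"
  then show "k = cls \<mu> \<tau> y" using eq by blast
qed

lemma topspace_arrows: "topspace (arrows G) = {cls \<mu> \<nu> x |\<mu> \<nu> x. (\<mu>, \<nu>, x) \<in> triples E B F}"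
  unfolding KP_groupoid_def top_groupoid.simps topology_generated_by_topspace cyl2_def triples_iff
  by blast

lemma topspace_units: "topspace (units G) = {x. \<exists>\<mu>\<in>mor E. x \<in> Z \<mu>}"
  unfolding KP_groupoid_def top_groupoid.simps path_topology_def topology_generated_by_topspace
  by blast

lemma arrowE:
  assumes "g \<in> topspace (arrows G)"
  obtains \<mu> \<nu> x where "(\<mu>, \<nu>, x) \<in> triples E B F" "g = cls \<mu> \<nu> x"
  using assms unfolding topspace_arrows by blast

lemma cls_arrow: "(\<mu>, \<nu>, x) \<in> triples E B F \<Longrightarrow> cls \<mu> \<nu> x \<in> topspace (arrows G)"
  unfolding topspace_arrows by blast

text \<open>The source of \<open>g\<close> passes through the inner legs of both arrows, so these legs have a common extension.\<close>

lemma composable_normal_form: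
  assumes "(g, h) \<in> gcomposable G"
  obtains \<mu> \<nu> \<tau> x y where "(\<mu>, \<nu>, x) \<in> triples E B F" "(\<nu>, \<tau>, y) \<in> triples E B F"
    "Res \<nu> x = Res \<tau> y" "g = cls \<mu> \<nu> x" "h = cls \<nu> \<tau> y"
proof -
  have gh: "g \<in> topspace (arrows G)" "h \<in> topspace (arrows G)" "gsrc G g = grng G h"
    using assms unfolding gcomposable_def by auto
  obtain \<mu> \<nu> x where t: "(\<mu>, \<nu>, x) \<in> triples E B F" "g = cls \<mu> \<nu> x" using arrowE[OF gh(1)] .
  obtain \<sigma> \<tau> y where s: "(\<sigma>, \<tau>, y) \<in> triples E B F" "h = cls \<sigma> \<tau> y" using arrowE[OF gh(2)] .
  have x: "x = transport \<sigma> \<tau> y" using gh(3) t s gsrc_cls grng_cls by simp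
  have m: "\<nu> \<in> mor E" "\<sigma> \<in> mor E" "x \<in> Z \<nu>" "x \<in> Z \<sigma>"
    using t(1) s(1) transport(1)[OF s(1)] x unfolding triples_iff by simp_all
  have "rng B (F \<nu>) = rng B (F \<sigma>)" using cyl_rng_eq[OF m(3,4)] m(1,2) by (metis F_simps(3))
  then obtain a b where "completes_cospan B (F \<nu>) (F \<sigma>) a b"
    using Ore[of "F \<nu>" "F \<sigma>"] m unfolding completes_cospan_def composable_def
    by (metis F_simps(1))
  from common_middle[OF t(1) s(1) x this] t(2) s(2) that show thesis by metis
qed

lemma common_extension_of_arrow:
  assumes "(\<mu>, \<nu>, x) \<in> triples E B F" "(\<mu>', \<nu>', x') \<in> triples E B F" "cls \<mu> \<nu> x = cls \<mu>' \<nu>' x'"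
  obtains \<gamma> \<gamma>' where "\<gamma> \<in> mor E" "\<gamma>' \<in> mor E" "src E \<nu> = rng E \<gamma>" "src E \<nu>' = rng E \<gamma>'"
    "\<mu> \<odot> \<gamma> = \<mu>' \<odot> \<gamma>'" "\<nu> \<odot> \<gamma> = \<nu>' \<odot> \<gamma>'" "Res \<nu> x \<in> Z \<gamma>" "Res \<nu>' x \<in> Z \<gamma>'" "x' = x"
proof -
  have r: "x' = x" "transport \<mu> \<nu> x = transport \<mu>' \<nu>' x" "same_degree (F \<mu>) (F \<nu>) (F \<mu>') (F \<nu>')"
    using assms(3) cls_eq_iff[OF assms(1,2)] unfolding rel_iff by auto
  obtain \<gamma> \<gamma>' where g: "\<gamma> \<in> mor E" "\<gamma>' \<in> mor E" "src E \<nu> = rng E \<gamma>" "src E \<nu>' = rng E \<gamma>'"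
    "\<mu> \<odot> \<gamma> = \<mu>' \<odot> \<gamma>'" "\<nu> \<odot> \<gamma> = \<nu>' \<odot> \<gamma>'" "x \<in> Z (\<nu> \<odot> \<gamma>)"
    using common_extension[OF assms(1) assms(2)[unfolded r(1)] r(2,3)] .
  have "Res \<nu> x \<in> Z \<gamma>" "Res \<nu>' x \<in> Z \<gamma>'"
    using cyl_mult_res_iff[OF _ g(1,3), of x] cyl_mult_res_iff[OF _ g(2,4), of x] g(6,7) assms(1,2)
    unfolding triples_iff by simp_all
  with that[OF g(1-6)] r(1) show thesis by blast
qed

lemma is_groupoid: "is_groupoid G"
proof -
  have 1: "grng G g \<in> topspace (units G)" "gsrc G g \<in> topspace (units G)"
    "ginv G g \<in> topspace (arrows G)" "grng G (ginv G g) = gsrc G g" "gsrc G (ginv G g) = grng G g"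
    "gmult G (gunit G (grng G g)) g = g" "gmult G g (gunit G (gsrc G g)) = g"
    "gmult G g (ginv G g) = gunit G (grng G g)" "gmult G (ginv G g) g = gunit G (gsrc G g)"
    if g: "g \<in> topspace (arrows G)" for g
  proof -
    obtain \<mu> \<nu> x where t: "(\<mu>, \<nu>, x) \<in> triples E B F" and g: "g = cls \<mu> \<nu> x" using arrowE[OF g] .
    let ?z = "transport \<mu> \<nu> x"
    have m: "\<mu> \<in> mor E" "\<nu> \<in> mor E" "x \<in> Z \<nu>" using t unfolding triples_iff by simp_all
    note z = transport[OF t] and s = triple_swap[OF t]
    have tm: "(\<mu>, \<mu>, ?z) \<in> triples E B F" and tn: "(\<nu>, \<nu>, x) \<in> triples E B F"
      using m z unfolding triples_iff by simp_all
    show "grng G g \<in> topspace (units G)" "gsrc G g \<in> topspace (units G)"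
      unfolding g grng_cls[OF t] gsrc_cls[OF t] topspace_units using m z by auto
    show "ginv G g \<in> topspace (arrows G)" unfolding g ginv_cls[OF t] by (rule cls_arrow[OF s(1)])
    show "grng G (ginv G g) = gsrc G g" "gsrc G (ginv G g) = grng G g"
      unfolding g ginv_cls[OF t] grng_cls[OF s(1)] gsrc_cls[OF s(1)] grng_cls[OF t] gsrc_cls[OF t]
      using s(2) by simp_all
    show "gmult G (gunit G (grng G g)) g = g"
      unfolding g grng_cls[OF t] gunit_eq[OF m(1) z(1)] by (rule gmult_cls[OF tm t z(2)])
    show "gmult G g (gunit G (gsrc G g)) = g"
      unfolding g gsrc_cls[OF t] gunit_eq[OF m(2,3)] by (rule gmult_cls[OF t tn refl])
    show "gmult G g (ginv G g) = gunit G (grng G g)"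
      unfolding g ginv_cls[OF t] grng_cls[OF t] gunit_eq[OF m(1) z(1)]
      by (rule gmult_cls[OF t s(1) z(2)[symmetric]])
    show "gmult G (ginv G g) g = gunit G (gsrc G g)"
      unfolding g ginv_cls[OF t] gsrc_cls[OF t] gunit_eq[OF m(2,3)]
      by (rule gmult_cls[OF s(1) t z(2)])
  qed
  have 2: "gunit G u \<in> topspace (arrows G)" "grng G (gunit G u) = u" "gsrc G (gunit G u) = u"
    if u: "u \<in> topspace (units G)" for u
  proof -
    obtain \<nu> where m: "\<nu> \<in> mor E" "u \<in> Z \<nu>" using u unfolding topspace_units by blast
    have t: "(\<nu>, \<nu>, u) \<in> triples E B F" using m unfolding triples_iff by simp
    show "gunit G u \<in> topspace (arrows G)" "grng G (gunit G u) = u" "gsrc G (gunit G u) = u"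
      unfolding gunit_eq[OF m] grng_cls[OF t] gsrc_cls[OF t]
      using cls_arrow[OF t] ind_res[OF m refl] by simp_all
  qed
  have 3: "gmult G g h \<in> topspace (arrows G)" "grng G (gmult G g h) = grng G g"
    "gsrc G (gmult G g h) = gsrc G h" if gh: "(g, h) \<in> gcomposable G" for g h
  proof -
    obtain \<mu> \<nu> \<tau> x y where t: "(\<mu>, \<nu>, x) \<in> triples E B F" "(\<nu>, \<tau>, y) \<in> triples E B F"
      "Res \<nu> x = Res \<tau> y" and g: "g = cls \<mu> \<nu> x" "h = cls \<nu> \<tau> y"
      using composable_normal_form[OF gh] .
    note u = transport_trans[OF t]
    show "gmult G g h \<in> topspace (arrows G)" "grng G (gmult G g h) = grng G g"
      "gsrc G (gmult G g h) = gsrc G h"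
      unfolding g gmult_cls[OF t] using cls_arrow[OF u(1)] grng_cls[OF u(1)] gsrc_cls[OF u(1)]
        grng_cls[OF t(1)] gsrc_cls[OF t(2)] u(3) by simp_all
  qed
  have 4: "gmult G (gmult G g h) k = gmult G g (gmult G h k)"
    if gh: "(g, h) \<in> gcomposable G" and hk: "(h, k) \<in> gcomposable G" for g h k
  proof -
    obtain \<mu> \<nu> \<tau> x y where t: "(\<mu>, \<nu>, x) \<in> triples E B F" "(\<nu>, \<tau>, y) \<in> triples E B F"
      "Res \<nu> x = Res \<tau> y" and g: "g = cls \<mu> \<nu> x" "h = cls \<nu> \<tau> y"
      using composable_normal_form[OF gh] .
    obtain \<nu>' \<tau>' \<rho> y' w where s: "(\<nu>', \<tau>', y') \<in> triples E B F" "(\<tau>', \<rho>, w) \<in> triples E B F"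
      "Res \<tau>' y' = Res \<rho> w" and h: "h = cls \<nu>' \<tau>' y'" "k = cls \<tau>' \<rho> w"
      using composable_normal_form[OF hk] .
    \<comment> \<open>The two normal forms of the middle arrow have a common extension, which puts all three
        arrows into one chain.\<close>
    obtain \<gamma> \<gamma>' where e: "\<gamma> \<in> mor E" "\<gamma>' \<in> mor E" "src E \<tau> = rng E \<gamma>" "src E \<tau>' = rng E \<gamma>'"
      "\<nu> \<odot> \<gamma> = \<nu>' \<odot> \<gamma>'" "\<tau> \<odot> \<gamma> = \<tau>' \<odot> \<gamma>'" "Res \<tau> y \<in> Z \<gamma>" "Res \<tau>' y \<in> Z \<gamma>'" "y' = y"
      using common_extension_of_arrow[OF t(2) s(1)] g(2) h(1) by metis
    have c: "src E \<nu> = rng E \<gamma>" "src E \<rho> = rng E \<gamma>'" "Res \<nu> x \<in> Z \<gamma>" "Res \<rho> w \<in> Z \<gamma>'"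
      "Res \<tau>' y = Res \<rho> w"
      using t s e unfolding triples_iff by simp_all
    note t1 = triple_extend[OF t(1) e(1) c(1,3)] and t2 = triple_extend[OF t(2) e(1,3,7)]
      and t3 = triple_extend[OF s(2) e(2) c(2,4), folded e(6)]
    have r: "Res (\<nu> \<odot> \<gamma>) x = Res (\<tau> \<odot> \<gamma>) y" "Res (\<tau> \<odot> \<gamma>) y = Res (\<rho> \<odot> \<gamma>') w"
      using triples_composable[OF t1(1) t2(1)] triples_composable[OF t2(1) t3(1)]
        t2(2) t3(2) transport_trans(2)[OF t] transport_trans(2)[OF s] e(9) by simp_all
    have g': "g = cls (\<mu> \<odot> \<gamma>) (\<nu> \<odot> \<gamma>) x" "h = cls (\<nu> \<odot> \<gamma>) (\<tau> \<odot> \<gamma>) y"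
      "k = cls (\<tau> \<odot> \<gamma>) (\<rho> \<odot> \<gamma>') w"
      using g h cls_extend[OF t(1) e(1) c(1,3)] cls_extend[OF t(2) e(1,3,7)]
        cls_extend[OF s(2) e(2) c(2,4), folded e(6)] by simp_all
    note u = transport_trans[OF t1(1) t2(1) r(1)] and v = transport_trans[OF t2(1) t3(1) r(2)]
    have "Res (\<nu> \<odot> \<gamma>) x = Res (\<rho> \<odot> \<gamma>') w" using r by simp
    then show ?thesis
      unfolding g' gmult_cls[OF t1(1) t2(1) r(1)] gmult_cls[OF t2(1) t3(1) r(2)]
      by (simp add: gmult_cls[OF u(1) t3(1) r(2)] gmult_cls[OF t1(1) v(1)])
  qed
  show ?thesis
    unfolding is_groupoid_def using 1 2 3 4 by (intro conjI ballI allI impI) auto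
qed

section \<open>The topology of the groupoid\<close>

abbreviation "Z2 \<equiv> cyl2 E B F"

lemma units_eq: "units G = path_topology E B F"
  unfolding KP_groupoid_def by simp

lemma openin_units_iff:
  "openin (units G) U \<longleftrightarrow> (\<forall>x\<in>U. \<exists>\<mu>\<in>mor E. x \<in> Z \<mu> \<and> Z \<mu> \<subseteq> U)"
proof -
  have base: "\<exists>W\<in>{Z \<alpha> |\<alpha>. \<alpha> \<in> mor E}. x \<in> W \<and> W \<subseteq> U \<inter> V"
    if U: "U \<in> {Z \<alpha> |\<alpha>. \<alpha> \<in> mor E}" and V: "V \<in> {Z \<alpha> |\<alpha>. \<alpha> \<in> mor E}" and x: "x \<in> U" "x \<in> V" for U V x
  proof -
    obtain \<mu> \<nu> where m: "\<mu> \<in> mor E" "\<nu> \<in> mor E" and UV: "U = Z \<mu>" "V = Z \<nu>" using U V by blast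
    obtain \<gamma> \<eta> where g: "\<gamma> \<in> mor E" "src E \<mu> = rng E \<gamma>" "\<eta> \<in> mor E" "src E \<nu> = rng E \<eta>"
      "\<mu> \<odot> \<gamma> = \<nu> \<odot> \<eta>" "x \<in> Z (\<mu> \<odot> \<gamma>)"
      using common_refinement[OF m(1) x(1)[unfolded UV] m(2) x(2)[unfolded UV]] .
    have "Z (\<mu> \<odot> \<gamma>) \<subseteq> U \<inter> V"
      using cyl_mult_iff[OF m(1) g(1,2)] cyl_mult_iff[OF m(2) g(3,4)] g(5) UV by auto
    moreover have "\<mu> \<odot> \<gamma> \<in> mor E" using m g by simp
    ultimately show ?thesis using g(6) by blast
  qed
  have "openin (units G) U \<longleftrightarrow> (\<forall>x\<in>U. \<exists>V\<in>{Z \<alpha> |\<alpha>. \<alpha> \<in> mor E}. x \<in> V \<and> V \<subseteq> U)"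
    unfolding units_eq path_topology_def by (rule openin_generated_by_base_iff) (rule base)
  then show ?thesis by (simp add: setcompr_eq_image)
qed

lemma cyl2E:
  assumes "g \<in> Z2 \<mu> \<nu>" "\<mu> \<in> mor E" "\<nu> \<in> mor E" "src E \<mu> = src E \<nu>"
  obtains x where "(\<mu>, \<nu>, x) \<in> triples E B F" "g = cls \<mu> \<nu> x"
  using assms unfolding cyl2_def triples_iff by blast

lemma cls_in_cyl2: "(\<mu>, \<nu>, x) \<in> triples E B F \<Longrightarrow> cls \<mu> \<nu> x \<in> Z2 \<mu> \<nu>"
  unfolding cyl2_def triples_iff by blast

lemma cyl2_extend_subset:
  assumes "\<mu> \<in> mor E" "\<nu> \<in> mor E" "src E \<mu> = src E \<nu>" "\<gamma> \<in> mor E" "src E \<nu> = rng E \<gamma>"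
  shows "Z2 (\<mu> \<odot> \<gamma>) (\<nu> \<odot> \<gamma>) \<subseteq> Z2 \<mu> \<nu>"
proof
  fix g assume "g \<in> Z2 (\<mu> \<odot> \<gamma>) (\<nu> \<odot> \<gamma>)"
  then obtain x where x: "x \<in> Z (\<nu> \<odot> \<gamma>)" and g: "g = cls (\<mu> \<odot> \<gamma>) (\<nu> \<odot> \<gamma>) x"
    unfolding cyl2_def by blast
  have x: "x \<in> Z \<nu>" "Res \<nu> x \<in> Z \<gamma>" using x cyl_mult_res_iff[OF assms(2,4,5)] by simp_all
  then have t: "(\<mu>, \<nu>, x) \<in> triples E B F" using assms(1-3) unfolding triples_iff by simp
  show "g \<in> Z2 \<mu> \<nu>" unfolding g cls_extend[OF t assms(4,5) x(2)] by (rule cls_in_cyl2[OF t])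
qed

text \<open>The extension does not depend on the way the arrow is written: every representative has a further
  extension whose basic set lies in the given one.\<close>

lemma cyl2_neighbourhood:
  assumes t: "(\<mu>, \<nu>, x) \<in> triples E B F" and a: "\<alpha> \<in> mor E" "\<beta> \<in> mor E" "src E \<alpha> = src E \<beta>"
    and mem: "cls \<mu> \<nu> x \<in> Z2 \<alpha> \<beta>"
  obtains \<gamma> where "\<gamma> \<in> mor E" "src E \<nu> = rng E \<gamma>" "Res \<nu> x \<in> Z \<gamma>"
    "Z2 (\<mu> \<odot> \<gamma>) (\<nu> \<odot> \<gamma>) \<subseteq> Z2 \<alpha> \<beta>"
proof -
  obtain y where y: "(\<alpha>, \<beta>, y) \<in> triples E B F" "cls \<mu> \<nu> x = cls \<alpha> \<beta> y" using cyl2E[OF mem a] .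
  obtain \<gamma> \<gamma>' where g: "\<gamma> \<in> mor E" "\<gamma>' \<in> mor E" "src E \<nu> = rng E \<gamma>" "src E \<beta> = rng E \<gamma>'"
    "\<mu> \<odot> \<gamma> = \<alpha> \<odot> \<gamma>'" "\<nu> \<odot> \<gamma> = \<beta> \<odot> \<gamma>'" "Res \<nu> x \<in> Z \<gamma>"
    using common_extension_of_arrow[OF t y] by metis
  show thesis
    using that[OF g(1,3,7)] cyl2_extend_subset[OF a g(2,4)] g(5,6) by simp
qed

lemma cls_extend_in_cyl2:
  assumes "(\<mu>, \<nu>, x) \<in> triples E B F" "\<gamma> \<in> mor E" "src E \<nu> = rng E \<gamma>" "Res \<nu> x \<in> Z \<gamma>"
  shows "cls \<mu> \<nu> x \<in> Z2 (\<mu> \<odot> \<gamma>) (\<nu> \<odot> \<gamma>)"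
  using cls_in_cyl2[OF triple_extend(1)[OF assms]] cls_extend[OF assms] by simp

lemma extend_parallel:
  assumes "(\<mu>, \<nu>, x) \<in> triples E B F" "\<gamma> \<in> mor E" "src E \<nu> = rng E \<gamma>"
  shows "\<mu> \<odot> \<gamma> \<in> mor E" "\<nu> \<odot> \<gamma> \<in> mor E" "src E (\<mu> \<odot> \<gamma>) = src E (\<nu> \<odot> \<gamma>)"
  using assms unfolding triples_iff by simp_all

lemma openin_arrows_iff:
  "openin (arrows G) U \<longleftrightarrow>
     (\<forall>g\<in>U. \<exists>\<mu>\<in>mor E. \<exists>\<nu>\<in>mor E. src E \<mu> = src E \<nu> \<and> g \<in> Z2 \<mu> \<nu> \<and> Z2 \<mu> \<nu> \<subseteq> U)"
proof -
  let ?S = "{Z2 \<mu> \<nu> |\<mu> \<nu>. \<mu> \<in> mor E \<and> \<nu> \<in> mor E \<and> src E \<mu> = src E \<nu>}"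
  have base: "\<exists>W\<in>?S. g \<in> W \<and> W \<subseteq> U \<inter> V" if U: "U \<in> ?S" and V: "V \<in> ?S" and g: "g \<in> U" "g \<in> V" for U V g
  proof -
    obtain \<mu> \<nu> where m: "\<mu> \<in> mor E" "\<nu> \<in> mor E" "src E \<mu> = src E \<nu>" and U: "U = Z2 \<mu> \<nu>" using U by blast
    obtain \<alpha> \<beta> where a: "\<alpha> \<in> mor E" "\<beta> \<in> mor E" "src E \<alpha> = src E \<beta>" and V: "V = Z2 \<alpha> \<beta>" using V by blast
    obtain x where t: "(\<mu>, \<nu>, x) \<in> triples E B F" and g': "g = cls \<mu> \<nu> x"
      using cyl2E[OF g(1)[unfolded U] m] .
    obtain \<gamma> where c: "\<gamma> \<in> mor E" "src E \<nu> = rng E \<gamma>" "Res \<nu> x \<in> Z \<gamma>"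
      and sub: "Z2 (\<mu> \<odot> \<gamma>) (\<nu> \<odot> \<gamma>) \<subseteq> Z2 \<alpha> \<beta>"
      using cyl2_neighbourhood[OF t a g(2)[unfolded V g']] .
    have "Z2 (\<mu> \<odot> \<gamma>) (\<nu> \<odot> \<gamma>) \<subseteq> U \<inter> V" using sub cyl2_extend_subset[OF m c(1,2)] U V by simp
    moreover have "g \<in> Z2 (\<mu> \<odot> \<gamma>) (\<nu> \<odot> \<gamma>)" unfolding g' by (rule cls_extend_in_cyl2[OF t c])
    ultimately show ?thesis using extend_parallel[OF t c(1,2)] by blast
  qed
  have "openin (arrows G) U \<longleftrightarrow> (\<forall>g\<in>U. \<exists>V\<in>?S. g \<in> V \<and> V \<subseteq> U)"
    unfolding KP_groupoid_def top_groupoid.simps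
    by (rule openin_generated_by_base_iff) (rule base)
  moreover have "(\<exists>V\<in>?S. g \<in> V \<and> V \<subseteq> U) \<longleftrightarrow>
    (\<exists>\<mu>\<in>mor E. \<exists>\<nu>\<in>mor E. src E \<mu> = src E \<nu> \<and> g \<in> Z2 \<mu> \<nu> \<and> Z2 \<mu> \<nu> \<subseteq> U)" for g
    unfolding Bex_def mem_Collect_eq by metis
  ultimately show ?thesis by simp
qed

lemma openin_cyl2:
  assumes "\<mu> \<in> mor E" "\<nu> \<in> mor E" "src E \<mu> = src E \<nu>"
  shows "openin (arrows G) (Z2 \<mu> \<nu>)"
  using assms unfolding openin_arrows_iff by blast

lemma continuous_into_arrows_iff:
  "continuous_map X (arrows G) f \<longleftrightarrow> f ` topspace X \<subseteq> topspace (arrows G) \<and>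
     (\<forall>\<alpha>\<in>mor E. \<forall>\<beta>\<in>mor E. src E \<alpha> = src E \<beta> \<longrightarrow> openin X (f -` Z2 \<alpha> \<beta> \<inter> topspace X))"
proof -
  define S where "S = {Z2 \<mu> \<nu> |\<mu> \<nu>. \<mu> \<in> mor E \<and> \<nu> \<in> mor E \<and> src E \<mu> = src E \<nu>}"
  have "arrows G = topology_generated_by S" unfolding KP_groupoid_def S_def by simp
  then have "continuous_map X (arrows G) f \<longleftrightarrow>
    (\<forall>U. U \<in> S \<longrightarrow> openin X (f -` U \<inter> topspace X)) \<and> f ` topspace X \<subseteq> topspace (arrows G)"
    by (simp add: continuous_on_generated_topo_iff topology_generated_by_topspace)
  then show ?thesis unfolding S_def by blast
qed

text \<open>Each path in \<open>Z(\<nu>)\<close> is the source of exactly one arrow in \<open>Z(\<mu>, \<nu>)\<close>. Surjectivity makes the source map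
  open, and injectivity is \<open>inj_on_gsrc_cyl2\<close>.\<close>

lemma cyl2_gsrc_image:
  assumes "\<mu> \<in> mor E" "\<nu> \<in> mor E" "src E \<mu> = src E \<nu>"
  shows "gsrc G ` Z2 \<mu> \<nu> = Z \<nu>"
proof -
  have "gsrc G (cls \<mu> \<nu> x) = x" if "x \<in> Z \<nu>" for x
    using gsrc_cls that assms unfolding triples_iff by simp
  then show ?thesis unfolding cyl2_def by force
qed

lemma cyl2_ginv:
  assumes "g \<in> Z2 \<mu> \<nu>" "\<mu> \<in> mor E" "\<nu> \<in> mor E" "src E \<mu> = src E \<nu>"
  shows "ginv G g \<in> Z2 \<nu> \<mu>"
proof -
  obtain x where t: "(\<mu>, \<nu>, x) \<in> triples E B F" and g: "g = cls \<mu> \<nu> x" using cyl2E[OF assms] .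
  show ?thesis unfolding g ginv_cls[OF t] by (rule cls_in_cyl2[OF triple_swap(1)[OF t]])
qed

lemma ginv_ginv:
  assumes "g \<in> topspace (arrows G)"
  shows "ginv G g \<in> topspace (arrows G)" "ginv G (ginv G g) = g" "gsrc G (ginv G g) = grng G g"
proof -
  obtain \<mu> \<nu> x where t: "(\<mu>, \<nu>, x) \<in> triples E B F" and g: "g = cls \<mu> \<nu> x" using arrowE[OF assms] .
  note s = triple_swap[OF t]
  show "ginv G g \<in> topspace (arrows G)" "ginv G (ginv G g) = g" "gsrc G (ginv G g) = grng G g"
    unfolding g ginv_cls[OF t] ginv_cls[OF s(1)] s(2) gsrc_cls[OF s(1)] grng_cls[OF t]
    by (rule cls_arrow[OF s(1)]) simp_all
qed

lemma cyl2_arrows: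
  assumes "\<mu> \<in> mor E" "\<nu> \<in> mor E" "src E \<mu> = src E \<nu>"
  shows "Z2 \<mu> \<nu> \<subseteq> topspace (arrows G)"
  using openin_subset[OF openin_cyl2[OF assms]] .

lemma ginv_image_cyl2:
  assumes "\<mu> \<in> mor E" "\<nu> \<in> mor E" "src E \<mu> = src E \<nu>"
  shows "ginv G ` Z2 \<mu> \<nu> = Z2 \<nu> \<mu>"
proof
  show "ginv G ` Z2 \<mu> \<nu> \<subseteq> Z2 \<nu> \<mu>" using cyl2_ginv assms by blast
  show "Z2 \<nu> \<mu> \<subseteq> ginv G ` Z2 \<mu> \<nu>"
  proof
    fix g assume g: "g \<in> Z2 \<nu> \<mu>"
    have "ginv G g \<in> Z2 \<mu> \<nu>" using cyl2_ginv[OF g] assms by simp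
    moreover have "g = ginv G (ginv G g)"
      using ginv_ginv(2)[of g] cyl2_arrows[of \<nu> \<mu>] g assms by auto
    ultimately show "g \<in> ginv G ` Z2 \<mu> \<nu>" by blast
  qed
qed

lemma continuous_ginv: "continuous_map (arrows G) (arrows G) (ginv G)"
  unfolding continuous_into_arrows_iff
proof (intro conjI ballI impI)
  show "ginv G ` topspace (arrows G) \<subseteq> topspace (arrows G)" using ginv_ginv by blast
  fix \<alpha> \<beta> assume a: "\<alpha> \<in> mor E" "\<beta> \<in> mor E" "src E \<alpha> = src E \<beta>"
  have "ginv G -` Z2 \<alpha> \<beta> \<inter> topspace (arrows G) = Z2 \<beta> \<alpha>"
    using cyl2_ginv a cyl2_arrows[of \<beta> \<alpha>] ginv_ginv by (auto; metis)
  then show "openin (arrows G) (ginv G -` Z2 \<alpha> \<beta> \<inter> topspace (arrows G))"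
    using openin_cyl2[of \<beta> \<alpha>] a by simp
qed

lemma arrow_closed:
  "g \<in> topspace (arrows G) \<Longrightarrow> gsrc G g \<in> topspace (units G)"
  "u \<in> topspace (units G) \<Longrightarrow> gunit G u \<in> topspace (arrows G)"
  "(g, h) \<in> gcomposable G \<Longrightarrow> gmult G g h \<in> topspace (arrows G)"
proof -
  note G = is_groupoid[unfolded is_groupoid_def]
  show "g \<in> topspace (arrows G) \<Longrightarrow> gsrc G g \<in> topspace (units G)"
    using G[THEN conjunct1] by simp
  show "u \<in> topspace (units G) \<Longrightarrow> gunit G u \<in> topspace (arrows G)"
    using G[THEN conjunct2, THEN conjunct1] by simp
  show "(g, h) \<in> gcomposable G \<Longrightarrow> gmult G g h \<in> topspace (arrows G)"
    using G[THEN conjunct2, THEN conjunct2, THEN conjunct1] by auto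
qed

text \<open>If \<open>x \<in> Z(\<nu>) \<inter> Z(\<kappa>)\<close>, a common refinement \<open>\<nu>\<gamma> = \<kappa>\<eta>\<close> gives the neighbourhood \<open>Z(\<mu>\<gamma>, \<nu>\<gamma>)\<close> of \<open>[\<mu>, \<nu>, x]\<close>,
  whose sources all lie in \<open>Z(\<kappa>)\<close>.\<close>

lemma continuous_gsrc: "continuous_map (arrows G) (units G) (gsrc G)"
  unfolding units_eq path_topology_def continuous_on_generated_topo_iff
proof (intro conjI allI impI)
  show "gsrc G ` topspace (arrows G) \<subseteq> \<Union>{Z \<alpha> |\<alpha>. \<alpha> \<in> mor E}"
    using arrow_closed(1) unfolding topspace_units by blast
  fix U assume "U \<in> {Z \<alpha> |\<alpha>. \<alpha> \<in> mor E}"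
  then obtain \<kappa> where k: "\<kappa> \<in> mor E" "U = Z \<kappa>" by blast
  show "openin (arrows G) (gsrc G -` U \<inter> topspace (arrows G))"
    unfolding openin_arrows_iff
  proof
    fix g assume g: "g \<in> gsrc G -` U \<inter> topspace (arrows G)"
    obtain \<mu> \<nu> x where t: "(\<mu>, \<nu>, x) \<in> triples E B F" and g': "g = cls \<mu> \<nu> x"
      using arrowE g by blast
    have m: "\<nu> \<in> mor E" "x \<in> Z \<nu>" using t unfolding triples_iff by simp_all
    have xk: "x \<in> Z \<kappa>" using g gsrc_cls[OF t] g' k by simp
    obtain \<gamma> \<eta> where c: "\<gamma> \<in> mor E" "src E \<nu> = rng E \<gamma>" "\<eta> \<in> mor E" "src E \<kappa> = rng E \<eta>"
      "\<nu> \<odot> \<gamma> = \<kappa> \<odot> \<eta>" "x \<in> Z (\<nu> \<odot> \<gamma>)"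
      using common_refinement[OF m k(1) xk] .
    have r: "Res \<nu> x \<in> Z \<gamma>" using cyl_mult_res_iff[OF m(1) c(1,2)] c(6) by simp
    note p = extend_parallel[OF t c(1,2)]
    have "Z (\<nu> \<odot> \<gamma>) \<subseteq> Z \<kappa>" unfolding c(5) using cyl_mult_iff[OF k(1) c(3,4)] by blast
    then have "Z2 (\<mu> \<odot> \<gamma>) (\<nu> \<odot> \<gamma>) \<subseteq> gsrc G -` U \<inter> topspace (arrows G)"
      using cyl2_gsrc_image[OF p] cyl2_arrows[OF p] k(2) by blast
    then show "\<exists>\<mu>\<in>mor E. \<exists>\<nu>\<in>mor E. src E \<mu> = src E \<nu> \<and> g \<in> Z2 \<mu> \<nu> \<and>
        Z2 \<mu> \<nu> \<subseteq> gsrc G -` U \<inter> topspace (arrows G)"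
      using p cls_extend_in_cyl2[OF t c(1,2) r] g' by blast
  qed
qed

lemma gsrc_open:
  assumes "openin (arrows G) U"
  shows "openin (units G) (gsrc G ` U)"
  unfolding openin_units_iff
proof
  fix x assume "x \<in> gsrc G ` U"
  then obtain g where g: "g \<in> U" "x = gsrc G g" by blast
  then obtain \<mu> \<nu> where m: "\<mu> \<in> mor E" "\<nu> \<in> mor E" "src E \<mu> = src E \<nu>" and "g \<in> Z2 \<mu> \<nu>" "Z2 \<mu> \<nu> \<subseteq> U"
    using assms unfolding openin_arrows_iff by blast
  then show "\<exists>\<nu>\<in>mor E. x \<in> Z \<nu> \<and> Z \<nu> \<subseteq> gsrc G ` U"
    using cyl2_gsrc_image[OF m] g(2) by blast
qed

lemma grng_eq: "g \<in> topspace (arrows G) \<Longrightarrow> grng G g = gsrc G (ginv G g)"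
  using ginv_ginv(3) by simp

lemma grng_image: "U \<subseteq> topspace (arrows G) \<Longrightarrow> grng G ` U = gsrc G ` ginv G ` U"
  unfolding image_image using grng_eq by (intro image_cong) auto

lemma cyl2_grng_image:
  assumes "\<mu> \<in> mor E" "\<nu> \<in> mor E" "src E \<mu> = src E \<nu>"
  shows "grng G ` Z2 \<mu> \<nu> = Z \<mu>"
  using grng_image[OF cyl2_arrows[OF assms]] ginv_image_cyl2[OF assms] cyl2_gsrc_image[of \<nu> \<mu>]
    assms by simp

lemma continuous_grng: "continuous_map (arrows G) (units G) (grng G)"
proof (rule continuous_map_eq)
  show "continuous_map (arrows G) (units G) (gsrc G \<circ> ginv G)"
    by (rule continuous_map_compose[OF continuous_ginv continuous_gsrc])
qed (simp add: grng_eq)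

lemma grng_open:
  assumes U: "openin (arrows G) U"
  shows "openin (units G) (grng G ` U)"
proof -
  have s: "U \<subseteq> topspace (arrows G)" using openin_subset[OF U] .
  have "ginv G ` U = ginv G -` U \<inter> topspace (arrows G)"
  proof
    show "ginv G ` U \<subseteq> ginv G -` U \<inter> topspace (arrows G)"
    proof (rule image_subsetI)
      fix g assume g: "g \<in> U"
      then show "ginv G g \<in> ginv G -` U \<inter> topspace (arrows G)"
        using ginv_ginv(1,2)[OF subsetD[OF s g]] by simp
    qed
    show "ginv G -` U \<inter> topspace (arrows G) \<subseteq> ginv G ` U"
    proof
      fix g assume "g \<in> ginv G -` U \<inter> topspace (arrows G)"
      then show "g \<in> ginv G ` U" using ginv_ginv(2)[of g] by (intro image_eqI[of _ _ "ginv G g"]) auto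
    qed
  qed
  then have "openin (arrows G) (ginv G ` U)"
    using openin_continuous_map_preimage[OF continuous_ginv U] by (simp add: vimage_def Int_def conj_commute)
  then show ?thesis unfolding grng_image[OF s] by (rule gsrc_open)
qed

lemma continuous_gunit: "continuous_map (units G) (arrows G) (gunit G)"
  unfolding continuous_into_arrows_iff
proof (intro conjI ballI impI)
  show "gunit G ` topspace (units G) \<subseteq> topspace (arrows G)"
    using arrow_closed(2) by blast
  fix \<alpha> \<beta> assume a: "\<alpha> \<in> mor E" "\<beta> \<in> mor E" "src E \<alpha> = src E \<beta>"
  show "openin (units G) (gunit G -` Z2 \<alpha> \<beta> \<inter> topspace (units G))"
    unfolding openin_units_iff
  proof
    fix x assume x: "x \<in> gunit G -` Z2 \<alpha> \<beta> \<inter> topspace (units G)"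
    then obtain \<mu> where m: "\<mu> \<in> mor E" "x \<in> Z \<mu>" unfolding topspace_units by blast
    have t: "(\<mu>, \<mu>, x) \<in> triples E B F" using m unfolding triples_iff by simp
    have "cls \<mu> \<mu> x \<in> Z2 \<alpha> \<beta>" using x gunit_eq[OF m] by simp
    then obtain \<gamma> where c: "\<gamma> \<in> mor E" "src E \<mu> = rng E \<gamma>" "Res \<mu> x \<in> Z \<gamma>"
      and sub: "Z2 (\<mu> \<odot> \<gamma>) (\<mu> \<odot> \<gamma>) \<subseteq> Z2 \<alpha> \<beta>"
      using cyl2_neighbourhood[OF t a] by blast
    have mc: "\<mu> \<odot> \<gamma> \<in> mor E" using m c by simp
    have "x \<in> Z (\<mu> \<odot> \<gamma>)" using cyl_mult_res_iff[OF m(1) c(1,2)] m c by simp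
    moreover have "y \<in> gunit G -` Z2 \<alpha> \<beta> \<inter> topspace (units G)" if y: "y \<in> Z (\<mu> \<odot> \<gamma>)" for y
    proof -
      have "(\<mu> \<odot> \<gamma>, \<mu> \<odot> \<gamma>, y) \<in> triples E B F" using mc y unfolding triples_iff by simp
      from subsetD[OF sub cls_in_cyl2[OF this]]
      have "gunit G y \<in> Z2 \<alpha> \<beta>" unfolding gunit_eq[OF mc y] .
      then show ?thesis using mc y unfolding topspace_units by blast
    qed
    ultimately show "\<exists>\<mu>\<in>mor E. x \<in> Z \<mu> \<and> Z \<mu> \<subseteq> gunit G -` Z2 \<alpha> \<beta> \<inter> topspace (units G)"
      using mc by blast
  qed
qed

lemma gmult_cyl2:
  assumes "g \<in> Z2 \<mu> \<nu>" "h \<in> Z2 \<nu> \<tau>" "gsrc G g = grng G h"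
    and "\<mu> \<in> mor E" "\<nu> \<in> mor E" "\<tau> \<in> mor E" "src E \<mu> = src E \<nu>" "src E \<nu> = src E \<tau>"
  shows "gmult G g h \<in> Z2 \<mu> \<tau>"
proof -
  obtain x where t: "(\<mu>, \<nu>, x) \<in> triples E B F" "g = cls \<mu> \<nu> x" using cyl2E[OF assms(1,4,5,7)] .
  obtain y where s: "(\<nu>, \<tau>, y) \<in> triples E B F" "h = cls \<nu> \<tau> y" using cyl2E[OF assms(2,5,6,8)] .
  have r: "Res \<nu> x = Res \<tau> y"
    using triples_composable[OF t(1) s(1)] assms(3) t s gsrc_cls grng_cls by simp
  show ?thesis
    unfolding t(2) s(2) gmult_cls[OF t(1) s(1) r]
    by (rule cls_in_cyl2[OF transport_trans(1)[OF t(1) s(1) r]])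
qed

text \<open>For \<open>[\<mu>, \<nu>, x]\<close> and \<open>[\<nu>, \<tau>, y]\<close> a neighbourhood of the product contains some \<open>Z(\<mu>\<gamma>, \<tau>\<gamma>)\<close>, and this
  contains all products of composable pairs from \<open>Z(\<mu>\<gamma>, \<nu>\<gamma>)\<close> and \<open>Z(\<nu>\<gamma>, \<tau>\<gamma>)\<close>.\<close>

lemma continuous_gmult:
  "continuous_map (subtopology (prod_topology (arrows G) (arrows G)) (gcomposable G)) (arrows G)
     (\<lambda>(g, h). gmult G g h)"
  (is "continuous_map ?P _ ?m")
proof -
  have tP: "topspace ?P = gcomposable G" unfolding gcomposable_def by auto
  have "openin ?P (?m -` Z2 \<alpha> \<beta> \<inter> topspace ?P)"
    if a: "\<alpha> \<in> mor E" "\<beta> \<in> mor E" "src E \<alpha> = src E \<beta>" for \<alpha> \<beta>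
  proof (subst openin_subopen, intro ballI)
    fix p assume p: "p \<in> ?m -` Z2 \<alpha> \<beta> \<inter> topspace ?P"
    obtain g h where gh: "p = (g, h)" by fastforce
    have comp: "(g, h) \<in> gcomposable G" using p gh unfolding tP by simp
    obtain \<mu> \<nu> \<tau> x y where t: "(\<mu>, \<nu>, x) \<in> triples E B F" "(\<nu>, \<tau>, y) \<in> triples E B F"
      "Res \<nu> x = Res \<tau> y" and g: "g = cls \<mu> \<nu> x" "h = cls \<nu> \<tau> y"
      using composable_normal_form[OF comp] .
    note u = transport_trans[OF t]
    have "cls \<mu> \<tau> y \<in> Z2 \<alpha> \<beta>" using p gmult_cls[OF t] gh g by simp
    then obtain \<gamma> where c: "\<gamma> \<in> mor E" "src E \<tau> = rng E \<gamma>" "Res \<tau> y \<in> Z \<gamma>"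
      and sub: "Z2 (\<mu> \<odot> \<gamma>) (\<tau> \<odot> \<gamma>) \<subseteq> Z2 \<alpha> \<beta>"
      using cyl2_neighbourhood[OF u(1) a] by blast
    have c': "src E \<nu> = rng E \<gamma>" "Res \<nu> x \<in> Z \<gamma>" using c t unfolding triples_iff by simp_all
    note p1 = extend_parallel[OF t(1) c(1) c'(1)] and p2 = extend_parallel[OF t(2) c(1,2)]
    let ?T = "(Z2 (\<mu> \<odot> \<gamma>) (\<nu> \<odot> \<gamma>) \<times> Z2 (\<nu> \<odot> \<gamma>) (\<tau> \<odot> \<gamma>)) \<inter> gcomposable G"
    have "openin ?P ?T"
    proof -
      have "openin (prod_topology (arrows G) (arrows G))
          (Z2 (\<mu> \<odot> \<gamma>) (\<nu> \<odot> \<gamma>) \<times> Z2 (\<nu> \<odot> \<gamma>) (\<tau> \<odot> \<gamma>))"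
        unfolding openin_prod_Times_iff using openin_cyl2[OF p1] openin_cyl2[OF p2] by simp
      then show ?thesis unfolding openin_subtopology by blast
    qed
    moreover have "p \<in> ?T"
      using cls_extend_in_cyl2[OF t(1) c(1) c'] cls_extend_in_cyl2[OF t(2) c] comp gh g by simp
    moreover have "?T \<subseteq> ?m -` Z2 \<alpha> \<beta> \<inter> topspace ?P"
    proof
      fix q assume q: "q \<in> ?T"
      obtain g' h' where q': "q = (g', h')" by fastforce
      have m: "g' \<in> Z2 (\<mu> \<odot> \<gamma>) (\<nu> \<odot> \<gamma>)" "h' \<in> Z2 (\<nu> \<odot> \<gamma>) (\<tau> \<odot> \<gamma>)" "gsrc G g' = grng G h'"
        using q q' unfolding gcomposable_def by simp_all
      have "gmult G g' h' \<in> Z2 (\<mu> \<odot> \<gamma>) (\<tau> \<odot> \<gamma>)"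
        by (rule gmult_cyl2[OF m p1(1,2) p2(2) p1(3) p2(3)])
      then show "q \<in> ?m -` Z2 \<alpha> \<beta> \<inter> topspace ?P" unfolding tP using q q' sub by auto
    qed
    ultimately show "\<exists>T. openin ?P T \<and> p \<in> T \<and> T \<subseteq> ?m -` Z2 \<alpha> \<beta> \<inter> topspace ?P" by blast
  qed
  moreover have "?m ` topspace ?P \<subseteq> topspace (arrows G)"
    unfolding tP using arrow_closed(3) by auto
  ultimately show ?thesis unfolding continuous_into_arrows_iff by blast
qed

lemma inj_on_gsrc_cyl2:
  assumes "\<mu> \<in> mor E" "\<nu> \<in> mor E" "src E \<mu> = src E \<nu>"
  shows "inj_on (gsrc G) (Z2 \<mu> \<nu>)"
proof (rule inj_onI)
  fix g h assume gh: "g \<in> Z2 \<mu> \<nu>" "h \<in> Z2 \<mu> \<nu>" "gsrc G g = gsrc G h"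
  obtain x where "(\<mu>, \<nu>, x) \<in> triples E B F" "g = cls \<mu> \<nu> x" using cyl2E[OF gh(1) assms] .
  moreover obtain y where "(\<mu>, \<nu>, y) \<in> triples E B F" "h = cls \<mu> \<nu> y" using cyl2E[OF gh(2) assms] .
  ultimately show "g = h" using gh(3) gsrc_cls by simp
qed

lemma inj_on_grng_cyl2:
  assumes "\<mu> \<in> mor E" "\<nu> \<in> mor E" "src E \<mu> = src E \<nu>"
  shows "inj_on (grng G) (Z2 \<mu> \<nu>)"
proof (rule inj_onI)
  fix g h assume gh: "g \<in> Z2 \<mu> \<nu>" "h \<in> Z2 \<mu> \<nu>" "grng G g = grng G h"
  have a: "g \<in> topspace (arrows G)" "h \<in> topspace (arrows G)" using gh cyl2_arrows[OF assms] by blast+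
  have "ginv G g = ginv G h"
    using inj_on_gsrc_cyl2[of \<nu> \<mu>] cyl2_ginv[OF gh(1) assms] cyl2_ginv[OF gh(2) assms] gh(3) assms
      grng_eq a by (auto dest: inj_onD)
  then show "g = h" using ginv_ginv(2)[OF a(1)] ginv_ginv(2)[OF a(2)] by metis
qed

lemma bisection_cyl2:
  assumes m: "\<mu> \<in> mor E" "\<nu> \<in> mor E" "src E \<mu> = src E \<nu>"
  shows "bisection G (Z2 \<mu> \<nu>)"
  using openin_cyl2[OF m] inj_on_gsrc_cyl2[OF m] inj_on_grng_cyl2[OF m] gsrc_open grng_open
  unfolding bisection_def open_map_def by (simp add: openin_open_subtopology)

lemma etale: "etale G"
proof -
  let ?\<B> = "{Z2 \<mu> \<nu> |\<mu> \<nu>. \<mu> \<in> mor E \<and> \<nu> \<in> mor E \<and> src E \<mu> = src E \<nu>}"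
  have "openin (arrows G) U \<longleftrightarrow> (arbitrary union_of (\<lambda>S. S \<in> ?\<B>)) U" for U
  proof
    assume "openin (arrows G) U"
    then have "\<exists>\<mu>\<in>mor E. \<exists>\<nu>\<in>mor E. src E \<mu> = src E \<nu> \<and> g \<in> Z2 \<mu> \<nu> \<and> Z2 \<mu> \<nu> \<subseteq> U" if "g \<in> U" for g
      using that unfolding openin_arrows_iff by (rule bspec)
    then have "U \<subseteq> \<Union>{S \<in> ?\<B>. S \<subseteq> U}"
      by (intro subsetI) (simp, metis)
    then have "U = \<Union>{S \<in> ?\<B>. S \<subseteq> U}" by blast
    then show "(arbitrary union_of (\<lambda>S. S \<in> ?\<B>)) U"
      unfolding union_of_def arbitrary_def by (intro exI[of _ "{S \<in> ?\<B>. S \<subseteq> U}"]) auto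
  next
    assume "(arbitrary union_of (\<lambda>S. S \<in> ?\<B>)) U"
    then obtain \<U> where "\<U> \<subseteq> ?\<B>" "\<Union>\<U> = U" unfolding union_of_def arbitrary_def by auto
    then show "openin (arrows G) U" using openin_cyl2 by (auto intro!: openin_Union)
  qed
  then have "openin (arrows G) = arbitrary union_of (\<lambda>S. S \<in> ?\<B>)" by blast
  moreover have "\<forall>S\<in>?\<B>. bisection G S" using bisection_cyl2 by blast
  moreover have "topological_groupoid G"
    unfolding topological_groupoid_def
    using is_groupoid continuous_grng continuous_gsrc continuous_gunit continuous_gmult continuous_ginv
    by blast
  ultimately show ?thesis unfolding etale_def by blast
qed

lemma cyl2_homeomorphisms:
  assumes m: "\<mu> \<in> mor E" "\<nu> \<in> mor E" "src E \<mu> = src E \<nu>"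
  shows "homeomorphic_map (subtopology (arrows G) (Z2 \<mu> \<nu>))
      (subtopology (path_topology E B F) (Z \<mu>)) (grng G)"
    and "homeomorphic_map (subtopology (arrows G) (Z2 \<mu> \<nu>))
      (subtopology (path_topology E B F) (Z \<nu>)) (gsrc G)"
  using homeomorphic_map_on_open[OF continuous_grng grng_open openin_cyl2[OF m] inj_on_grng_cyl2[OF m]]
    homeomorphic_map_on_open[OF continuous_gsrc gsrc_open openin_cyl2[OF m] inj_on_gsrc_cyl2[OF m]]
  unfolding cyl2_grng_image[OF m] cyl2_gsrc_image[OF m] units_eq by blast+

end

theorem lemma4p15:
  fixes E :: "'e cat" and B :: "'b cat" and F :: "'e \<Rightarrow> 'b"
  assumes "Kumjian_Pask_fibration E B F"
  shows "(\<forall>\<mu>\<in>mor E. \<forall>\<nu>\<in>mor E. src E \<mu> = src E \<nu> \<longrightarrow>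
            homeomorphic_map
              (subtopology (arrows (KP_groupoid E B F)) (cyl2 E B F \<mu> \<nu>))
              (subtopology (path_topology E B F) (cyl E B F \<mu>))
              (grng (KP_groupoid E B F)) \<and>
            homeomorphic_map
              (subtopology (arrows (KP_groupoid E B F)) (cyl2 E B F \<mu> \<nu>))
              (subtopology (path_topology E B F) (cyl E B F \<nu>))
              (gsrc (KP_groupoid E B F))) \<and>
         etale (KP_groupoid E B F)"
proof -
  interpret KP_fibration E B F using assms by unfold_locales
  show ?thesis using cyl2_homeomorphisms etale by blast
qed

end
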